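(* Let $\nu$ be a $\Phi$-invariant Borel measure on $X$ which is robustly renormalizable, and let $\mathbf 1:X\to\mathbb R$ be the constant function with value $1$. Then for all integers $n\ge0$, $$\nu(\mathcal O_n)=\int_X C(\nu,n)(\mathbf 1)(x)\,d(\nu\circ\rho^{-n})(x),$$ and $\nu(\mathit{NS})=\lim_{n\to\infty}\nu(\mathcal O_n)$.
   Context: $\Omega_\pm=\{\pm1\}^{\mathbb Z}$ with the product topology, $\sigma(\omega)_n=\omega_{n+1}$, $N=\{(1,0),(0,1),(-1,0),(0,-1)\}$, $X=\Omega_\pm\times\Omega_\pm\times N$. The map $\Phi:X\to X$ is the bijection $$\Phi(\omega,\omega',(a,b))=(\sigma^{sb}(\omega),\sigma^{sa}(\omega'),s(b,a)),\qquad s=\omega_0\omega'_0 .$$ A point $(\omega,\omega',\mathbf v)\in X$ has a stable periodic orbit if for some $n\ge1$ there are open neighborhoods $U$ of $\omega$ and $U'$ of $\omega'$ such that $\Phi^n(\eta,\eta',\mathbf v)=(\eta,\eta',\mathbf v)$ for all $(\eta,\eta')\in U\times U'$. $\mathit{NS}$ is the set of points of $X$ without a stable periodic orbit. Collapsing map: let $S=\{\omega:\omega_0=-1,\omega_1=1\}\cup\{\omega:\omega_{-1}=-1,\omega_0=1\}\subset\Omega_\pm$ and $K(\omega)=\{k\in\mathbb Z:\sigma^k(\omega)\notin S\}$. The sequence $\omega$ is unbounded-collapsible if $K(\omega)$ is unbounded above and below, zero-collapsible if $0\in K(\omega)$, and collapsible if both hold. $C$ is the set of collapsible elements. For $\omega\in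 C$, index $K(\omega)=\{k_i:i\in\mathbb Z\}$ increasingly with $k_0=0$ and define $c(\omega)_i=\omega_{k_i}$. Let $\mathcal R_1=C\times C\times N$ and $\rho:\mathcal R_1\to X$, $\rho(\omega,\omega',\mathbf v)=(c(\omega),c(\omega'),\mathbf v)$. $\mathcal R_n=\rho^{-n}(X)$ is the set of $x\in X$ for which $\rho^k(x)$ is defined for all $1\le k\le n$ ($\mathcal R_0=X$). $\mathcal O_n=\bigcup_{m\in\mathbb Z}\Phi^m(\mathcal R_n)$. $\nu\circ\rho^{-n}$ is the measure $B\mapsto\nu(\{x\in\mathcal R_n:\rho^n(x)\in B\})$ on $X$. $\mathit{NUC}$ is the set of $(\omega,\omega',\mathbf v)\in X$ such that $\omega$ or $\omega'$ is not unbounded-collapsible. A Borel measure $\nu$ on $X$ is robustly renormalizable if $\nu\circ\rho^{-n}(\mathit{NUC})=0$ for all integers $n\ge0$. For $x\in\mathcal R_n$, the return time $R_n(x)$ is the smallest integer $m>0$ with $\Phi^m(x)\in\mathcal R_n$ (it always exists). For Borel measurable $f:X\to\mathbb R$, let $r_n(f;x)=\sum_{i=0}^{R_n(x)-1}f(\Phi^i(x))$ for $x\in\mathcal R_n$. For $\Phi$-invariant $\nu$, $C(\nu,n)(f):X\to\mathbb R$ denotes the conditional expectation of $r_n(f;\cdot)$ given $\rho^n$, i.e. the ($\nu\circ\rho^{-n}$-a.e. unique) Borel measurable function such that for all Borel $B\subset X$ $$\int_{\rho^{-n}(B)}r_n(f;x)\,d\nu(x)=\int_B C(\nu,n)(f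)(x)\,d(\nu\circ\rho^{-n})(x).$$
   Formalization: The Borel measure ν is assumed finite; for infinite Φ-invariant robustly renormalizable measures the limit formula can fail (ν(O_n)=∞ for all n while ν(NS)=0) and C(ν,n) need not be well defined. *)

theory Defs
  imports "HOL-Analysis.Analysis"
begin

text \<open>
  Sign sequences are functions from \<^typ>\<open>int\<close> to \<^typ>\<open>int\<close> with values in \<open>{1, -1}\<close>.
  Since \<^typ>\<open>int\<close> carries the discrete topology, the library topology on the function type
  is the product topology, and \<open>Omega\<close> and \<open>X\<close> carry the induced subspace topologies.
  Operations below are total on the ambient type and meaningful on \<open>X\<close>.
\<close>

type_synonym sequ = "int \<Rightarrow> int"
type_synonym point = "sequ \<times> sequ \<times> (int \<times> int)"

definition Omega :: "sequ set" where
  "Omega = {\<omega>. \<forall>n. \<omega> n \<in> {1, -1}}"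

definition N :: "(int \<times> int) set" where
  "N = {(1, 0), (0, 1), (-1, 0), (0, -1)}"

definition X :: "point set" where
  "X = Omega \<times> Omega \<times> N"

definition borelX :: "point measure" where
  "borelX = restrict_space borel X"

text \<open>\<open>shift k\<close> is the \<open>k\<close>-th iterate of the left shift, for any integer \<open>k\<close>.\<close>

definition shift :: "int \<Rightarrow> sequ \<Rightarrow> sequ" where
  "shift k \<omega> = (\<lambda>n. \<omega> (n + k))"

fun Phi :: "point \<Rightarrow> point" where
  "Phi (\<omega>, \<omega>', (a, b)) =
     (let s = \<omega> 0 * \<omega>' 0 in (shift (s * b) \<omega>, shift (s * a) \<omega>', (s * b, s * a)))"

definition Phi_pow :: "int \<Rightarrow> point \<Rightarrow> point" where
  "Phi_pow m = (if 0 \<le> m then Phi ^^ nat m else inv_into X Phi ^^ nat (- m))"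

fun stable_periodic :: "point \<Rightarrow> bool" where
  "stable_periodic (\<omega>, \<omega>', v) \<longleftrightarrow>
     (\<exists>n\<ge>1. \<exists>U U'. openin (top_of_set Omega) U \<and> \<omega> \<in> U \<and>
        openin (top_of_set Omega) U' \<and> \<omega>' \<in> U' \<and>
        (\<forall>\<eta>\<in>U. \<forall>\<eta>'\<in>U'. (Phi ^^ n) (\<eta>, \<eta>', v) = (\<eta>, \<eta>', v)))"

definition NS :: "point set" where
  "NS = {x \<in> X. \<not> stable_periodic x}"

definition S :: "sequ set" where
  "S = {\<omega> \<in> Omega. \<omega> 0 = -1 \<and> \<omega> 1 = 1} \<union> {\<omega> \<in> Omega. \<omega> (-1) = -1 \<and> \<omega> 0 = 1}"

definition K :: "sequ \<Rightarrow> int set" where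
  "K \<omega> = {k. shift k \<omega> \<notin> S}"

definition unbounded_collapsible :: "sequ \<Rightarrow> bool" where
  "unbounded_collapsible \<omega> \<longleftrightarrow> \<not> bdd_above (K \<omega>) \<and> \<not> bdd_below (K \<omega>)"

definition zero_collapsible :: "sequ \<Rightarrow> bool" where
  "zero_collapsible \<omega> \<longleftrightarrow> 0 \<in> K \<omega>"

definition collapsibles :: "sequ set" where
  "collapsibles = {\<omega> \<in> Omega. unbounded_collapsible \<omega> \<and> zero_collapsible \<omega>}"

definition K_index :: "sequ \<Rightarrow> int \<Rightarrow> int" where
  "K_index \<omega> = (THE k. strict_mono k \<and> range k = K \<omega> \<and> k 0 = 0)"

definition collapse :: "sequ \<Rightarrow> sequ" where
  "collapse \<omega> = (\<lambda>i. \<omega> (K_index \<omega> i))"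

fun rho :: "point \<Rightarrow> point" where
  "rho (\<omega>, \<omega>', v) = (collapse \<omega>, collapse \<omega>', v)"

text \<open>\<open>ren n\<close> is the domain \<open>\<R>\<^sub>n = \<rho>\<^bsup>-n\<^esup>(X)\<close> of the \<open>n\<close>-th iterate of the partial map \<open>\<rho>\<close>,
  whose own domain is \<open>collapsibles \<times> collapsibles \<times> N\<close>.\<close>

primrec ren :: "nat \<Rightarrow> point set" where
  "ren 0 = X"
| "ren (Suc n) = {x \<in> collapsibles \<times> collapsibles \<times> N. rho x \<in> ren n}"

definition orb :: "nat \<Rightarrow> point set" where
  "orb n = (\<Union>m::int. Phi_pow m ` ren n)"

text \<open>\<open>push \<nu> n\<close> is \<open>\<nu> \<circ> \<rho>\<^bsup>-n\<^esup>\<close>, i.e. it sends \<open>B\<close> to \<open>\<nu> {x \<in> ren n. (rho ^^ n) x \<in> B}\<close>.\<close>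

definition push :: "point measure \<Rightarrow> nat \<Rightarrow> point measure" where
  "push \<nu> n = distr (restrict_space \<nu> (ren n)) borelX (rho ^^ n)"

definition NUC :: "point set" where
  "NUC = {(\<omega>, \<omega>', v) \<in> X. \<not> unbounded_collapsible \<omega> \<or> \<not> unbounded_collapsible \<omega>'}"

definition robustly_renormalizable :: "point measure \<Rightarrow> bool" where
  "robustly_renormalizable \<nu> \<longleftrightarrow> (\<forall>n. emeasure (push \<nu> n) NUC = 0)"

definition Phi_invariant :: "point measure \<Rightarrow> bool" where
  "Phi_invariant \<nu> \<longleftrightarrow> (\<forall>A\<in>sets borelX. emeasure \<nu> {x \<in> X. Phi x \<in> A} = emeasure \<nu> A)"

definition return_time :: "nat \<Rightarrow> point \<Rightarrow> nat" where
  "return_time n x = (LEAST m. 0 < m \<and> (Phi ^^ m) x \<in> ren n)"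

definition return_sum :: "nat \<Rightarrow> (point \<Rightarrow> real) \<Rightarrow> point \<Rightarrow> real" where
  "return_sum n f x = (\<Sum>i<return_time n x. f ((Phi ^^ i) x))"

text \<open>\<open>g\<close> is a version of the conditional expectation of \<open>return_sum n f\<close> given \<open>\<rho>\<^sup>n\<close>.
  Integrability is demanded because the Bochner integral of a non-integrable function is \<open>0\<close>;
  Borel measurability of \<open>g\<close> is part of its integrability.\<close>

definition is_return_cond_exp ::
    "point measure \<Rightarrow> nat \<Rightarrow> (point \<Rightarrow> real) \<Rightarrow> (point \<Rightarrow> real) \<Rightarrow> bool" where
  "is_return_cond_exp \<nu> n f g \<longleftrightarrow>
     set_integrable \<nu> (ren n) (return_sum n f) \<and> integrable (push \<nu> n) g \<and>
     (\<forall>B\<in>sets borelX.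
        (LINT x:{x \<in> ren n. (rho ^^ n) x \<in> B}|\<nu>. return_sum n f x) = (LINT x:B|push \<nu> n. g x))"

text \<open>The operator \<open>C(\<nu>, n)\<close>: versions are unique up to \<open>push \<nu> n\<close>-null sets, so the choice
  does not affect integrals.\<close>

definition return_cond_exp :: "point measure \<Rightarrow> nat \<Rightarrow> (point \<Rightarrow> real) \<Rightarrow> point \<Rightarrow> real" where
  "return_cond_exp \<nu> n f = (SOME g. is_return_cond_exp \<nu> n f g)"

end

theory Submission
  imports Defs
begin

text \<open>
  Lifting \<open>\<Phi>\<close> to \<open>\<int>\<^sup>2\<close> with \<open>\<omega>\<close>, \<open>\<omega>'\<close> fixed turns an orbit into a lattice path, and a point
  has a stable periodic orbit iff its lifted path closes up. A path through a kept column
  crosses a deleted pair of rows by a detour of four steps that ends in the same column, so the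
  first return map to \<open>\<R>\<^sub>1\<close> is carried by \<open>\<rho>\<close> to \<open>\<Phi>\<close>. Hence \<open>x \<in> \<R>\<^sub>1\<close> has a closed path iff \<open>\<rho>(x)\<close>
  has one, and the latter is strictly shorter because no closed path stays in the kept rows and
  columns: a closed path of a point of \<open>\<R>\<^sub>n\<close> is longer than \<open>n\<close>, and \<open>\<Inter>\<O>\<^sub>n \<subseteq> NS\<close>. Conversely, if both
  sequences are unbounded-collapsible, a path that never meets \<open>\<R>\<^sub>1\<close> is a four-cycle; so by robust
  renormalizability almost every point of \<open>NS\<close> lies in every \<open>\<O>\<^sub>n\<close>. The formula for \<open>\<nu>(\<O>\<^sub>n)\<close> is
  Kac's lemma for the first return to \<open>\<R>\<^sub>n\<close>.
\<close>

text \<open>Closing of the lifted path is stronger than periodicity under \<open>Phi\<close>: if the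
  sequences have periods of their own, an orbit may return with nonzero displacement. Changing one
  far coordinate destroys such a return, which is why stability sees exactly the closed paths. The
  passage from \<open>NS\<close> into the next renormalization domain cannot be made for every
  point, since the renormalized sequences may fail to be unbounded-collapsible; it is made off a
  null set, and this null set has to be avoided at all times of the orbit, which is where invariance
  enters. Orbits in \<open>orb n\<close> are two-sided, whereas entrance and return are forward
  notions. The work is therefore done with \<open>entering n\<close>, the points whose forward orbit
  meets \<open>ren n\<close>; invariance gives it the same measure as \<open>orb n\<close>. Finally,
  \<open>return_cond_exp\<close> is a choice among versions, so a version has to be exhibited: it is
  a Radon-Nikodym derivative, and the return time formula itself supplies the finiteness that its
  construction needs.\<close>

lemma Omega_cases: "w \<in> Omega \<Longrightarrow> w k = 1 \<or> w k = -1"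
  by (auto simp: Omega_def)

lemma shift_Omega [simp]: "shift k w \<in> Omega \<longleftrightarrow> w \<in> Omega"
proof
  assume a: "shift k w \<in> Omega"
  have "w n \<in> {1, -1}" for n
    using a[unfolded Omega_def shift_def, simplified, rule_format, of "n - k"] by simp
  then show "w \<in> Omega" by (simp add: Omega_def)
qed (auto simp: Omega_def shift_def)

lemma shift_0 [simp]: "shift 0 w = w"
  by (simp add: shift_def)

lemma shift_shift [simp]: "shift k (shift l w) = shift (k + l) w"
  by (simp add: shift_def add.assoc)

text \<open>The deleted indices come in pairs; the partner of \<open>k\<close> is \<open>k - w k\<close>.\<close>

lemma in_K_iff:
  assumes "w \<in> Omega"
  shows "k \<in> K w \<longleftrightarrow> w (k - w k) = w k"
  using Omega_cases[OF assms, of k]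
proof
  assume "w k = 1"
  then show ?thesis
    using Omega_cases[OF assms, of "k - 1"] assms by (auto simp: K_def S_def shift_def[of k w])
next
  assume "w k = -1"
  then show ?thesis
    using Omega_cases[OF assms, of "k + 1"] assms
    by (auto simp: K_def S_def shift_def[of k w] add.commute)
qed

lemma notin_K_iff:
  assumes "w \<in> Omega"
  shows "k \<notin> K w \<longleftrightarrow> w (k - w k) = - w k"
  using Omega_cases[OF assms, of k] Omega_cases[OF assms, of "k - w k"]
  by (auto simp: in_K_iff[OF assms])

lemma K_shift: "K (shift k w) = {i. i + k \<in> K w}"
  by (simp add: K_def)

lemma unbounded_collapsible_iff:
  "unbounded_collapsible w \<longleftrightarrow> (\<forall>n. \<exists>k\<in>K w. n < k) \<and> (\<forall>n. \<exists>k\<in>K w. k < n)"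
  unfolding unbounded_collapsible_def bdd_above_def bdd_below_def by (meson not_le)

lemma unbounded_collapsible_shift [simp]:
  "unbounded_collapsible (shift k w) \<longleftrightarrow> unbounded_collapsible w"
proof -
  have "(\<exists>i. i + k \<in> K w \<and> n < i) \<longleftrightarrow> (\<exists>j\<in>K w. n + k < j)" for n
  proof
    assume "\<exists>j\<in>K w. n + k < j"
    then obtain j where "j \<in> K w" "n + k < j" by blast
    then show "\<exists>i. i + k \<in> K w \<and> n < i" by (intro exI[of _ "j - k"]) auto
  qed force
  moreover have "(\<exists>i. i + k \<in> K w \<and> i < n) \<longleftrightarrow> (\<exists>j\<in>K w. j < n + k)" for n
  proof
    assume "\<exists>j\<in>K w. j < n + k"
    then obtain j where "j \<in> K w" "j < n + k" by blast
    then show "\<exists>i. i + k \<in> K w \<and> i < n" by (intro exI[of _ "j - k"]) auto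
  qed force
  moreover have "(\<forall>n. P (n + k)) \<longleftrightarrow> (\<forall>n. P n)" for P :: "int \<Rightarrow> bool"
    by (metis diff_add_cancel)
  from this[of "\<lambda>n. \<exists>j\<in>K w. n < j"] this[of "\<lambda>n. \<exists>j\<in>K w. j < n"]
  have "(\<forall>n. \<exists>j\<in>K w. n + k < j) \<longleftrightarrow> (\<forall>n. \<exists>j\<in>K w. n < j)"
    "(\<forall>n. \<exists>j\<in>K w. j < n + k) \<longleftrightarrow> (\<forall>n. \<exists>j\<in>K w. j < n)" .
  ultimately show ?thesis
    by (simp add: unbounded_collapsible_iff K_shift)
qed

text \<open>The sign \<open>d\<close> serves both directions at once. The search starts at
  \<open>n\<close> itself, so \<open>j = 0\<close> is possible.\<close>

lemma unbounded_collapsible_next: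
  fixes d :: int
  assumes "unbounded_collapsible w" "d = 1 \<or> d = -1"
  obtains j where "n + d * int j \<in> K w" "\<And>i. i < j \<Longrightarrow> n + d * int i \<notin> K w"
proof -
  have "\<exists>j. n + d * int j \<in> K w"
  proof (cases "d = 1")
    case True
    obtain k where "k \<in> K w" "n < k" using assms by (auto simp: unbounded_collapsible_iff)
    with True show ?thesis by (intro exI[of _ "nat (k - n)"]) auto
  next
    case False
    obtain k where "k \<in> K w" "k < n" using assms by (auto simp: unbounded_collapsible_iff)
    with False assms show ?thesis by (intro exI[of _ "nat (n - k)"]) auto
  qed
  then have "n + d * int (LEAST j. n + d * int j \<in> K w) \<in> K w" by (rule LeastI_ex)
  then show ?thesis by (rule that) (rule not_less_Least)
qed

lemma shift_in_collapsibles_iff: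
  "w \<in> Omega \<Longrightarrow> shift k w \<in> collapsibles \<longleftrightarrow> unbounded_collapsible w \<and> k \<in> K w"
  by (simp add: collapsibles_def zero_collapsible_def K_shift)

lemma in_collapsibles_iff:
  "w \<in> collapsibles \<longleftrightarrow> w \<in> Omega \<and> unbounded_collapsible w \<and> 0 \<in> K w"
  by (simp add: collapsibles_def zero_collapsible_def)

subsection \<open>Enumeration of kept indices\<close>

text \<open>From a common value, the next one in either direction is determined by the range alone.
  This makes the \<open>THE\<close> in \<open>K_index\<close> well defined.\<close>

lemma strict_mono_int_range_unique:
  fixes k k' :: "int \<Rightarrow> int"
  assumes k: "strict_mono k" and k': "strict_mono k'" and r: "range k = range k'"
    and 0: "k 0 = k' 0"
  shows "k = k'"
proof
  have le: "h (i + 1) \<le> h' (i + 1)"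
    if h: "strict_mono h" and h': "strict_mono h'" and r: "range h = range h'" and i: "h i = h' i"
    for h h' :: "int \<Rightarrow> int" and i
  proof -
    have "h' (i + 1) \<in> range h" using r by simp
    then obtain j where j: "h' (i + 1) = h j" by (rule rangeE)
    have "h' i < h' (i + 1)" using h' by (simp add: strict_mono_less)
    then have "h i < h j" using i j by simp
    then have "i + 1 \<le> j" using h by (simp add: strict_mono_less)
    then show ?thesis using j h by (simp add: strict_mono_less_eq)
  qed
  have ge: "h' (i - 1) \<le> h (i - 1)"
    if h: "strict_mono h" and h': "strict_mono h'" and r: "range h = range h'" and i: "h i = h' i"
    for h h' :: "int \<Rightarrow> int" and i
  proof -
    have "h' (i - 1) \<in> range h" using r by simp
    then obtain j where j: "h' (i - 1) = h j" by (rule rangeE)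
    have "h' (i - 1) < h' i" using h' by (simp add: strict_mono_less)
    then have "h j < h i" using i j by simp
    then have "j \<le> i - 1" using h by (simp add: strict_mono_less)
    then show ?thesis using j h by (simp add: strict_mono_less_eq)
  qed
  fix i
  show "k i = k' i"
  proof (induction i rule: int_induct[where k = 0])
    case (step1 i)
    then show ?case using le[OF k k' r step1.IH] le[OF k' k r[symmetric] step1.IH[symmetric]] by simp
  next
    case (step2 i)
    then show ?case using ge[OF k k' r step2.IH] ge[OF k' k r[symmetric] step2.IH[symmetric]] by simp
  qed (rule 0)
qed

lemma enumerate_unbounded_int_set:
  fixes A :: "int set"
  assumes up: "\<And>n. \<exists>k\<in>A. n < k" and dn: "\<And>n. \<exists>k\<in>A. k < n" and "0 \<in> A"
  obtains k :: "int \<Rightarrow> int" where "strict_mono k" "range k = A" "k 0 = 0"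
proof -
  \<comment> \<open>The two halves of \<open>A\<close> are enumerated outwards from 0 as sets of
    naturals; 0 is the first element of each, so the halves fit together there.\<close>
  define P where "P = {n. int n \<in> A}"
  define Q where "Q = {n. - int n \<in> A}"
  have iP: "infinite P"
    unfolding infinite_nat_iff_unbounded
  proof
    fix m
    obtain k where "k \<in> A" "int m < k" using up by blast
    then show "\<exists>n>m. n \<in> P" by (intro exI[of _ "nat k"]) (auto simp: P_def)
  qed
  have iQ: "infinite Q"
    unfolding infinite_nat_iff_unbounded
  proof
    fix m
    obtain k where "k \<in> A" "k < - int m" using dn by blast
    then show "\<exists>n>m. n \<in> Q" by (intro exI[of _ "nat (- k)"]) (auto simp: Q_def)
  qed
  have P0: "enumerate P 0 = 0" and Q0: "enumerate Q 0 = 0"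
    using \<open>0 \<in> A\<close> by (auto simp: enumerate_0 P_def Q_def intro!: Least_equality)
  define k where "k i = (if 0 \<le> i then int (enumerate P (nat i)) else - int (enumerate Q (nat (- i))))" for i
  have "strict_mono k"
  proof (rule strict_monoI)
    fix i j :: int assume "i < j"
    consider "0 \<le> i" | "i < 0" "0 \<le> j" | "j < 0" by linarith
    then show "k i < k j"
    proof cases
      case 1
      then show ?thesis using \<open>i < j\<close> enumerate_mono[OF _ iP, of "nat i" "nat j"] by (simp add: k_def)
    next
      case 2
      then show ?thesis using enumerate_mono[OF _ iQ, of 0 "nat (- i)"] Q0 by (simp add: k_def)
    next
      case 3
      then show ?thesis using \<open>i < j\<close> enumerate_mono[OF _ iQ, of "nat (- j)" "nat (- i)"] by (simp add: k_def)
    qed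
  qed
  moreover have "range k = A"
  proof (intro equalityI subsetI)
    fix a assume "a \<in> range k"
    then show "a \<in> A"
      using enumerate_in_set[OF iP] enumerate_in_set[OF iQ] by (auto simp: k_def P_def Q_def)
  next
    fix a assume a: "a \<in> A"
    show "a \<in> range k"
    proof (cases "0 \<le> a")
      case True
      then have "nat a \<in> P" using a by (simp add: P_def)
      then obtain n where "enumerate P n = nat a" using enumerate_Ex[OF iP] by blast
      then have "k (int n) = a" using True by (simp add: k_def)
      then show ?thesis by blast
    next
      case False
      then have "nat (- a) \<in> Q" using a by (simp add: Q_def)
      then obtain n where n: "enumerate Q n = nat (- a)" using enumerate_Ex[OF iQ] by blast
      then have "n \<noteq> 0" using False Q0 by (intro notI) auto
      then have "k (- int n) = a" using False n by (simp add: k_def)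
      then show ?thesis by blast
    qed
  qed
  moreover have "k 0 = 0" by (simp add: k_def P0)
  ultimately show ?thesis using that by blast
qed

lemma K_index_eqI:
  assumes "strict_mono k" "range k = K w" "k 0 = 0"
  shows "K_index w = k"
  unfolding K_index_def
  by (rule the_equality) (use assms strict_mono_int_range_unique in auto)

lemma K_index:
  assumes "w \<in> collapsibles"
  shows strict_mono_K_index: "strict_mono (K_index w)"
    and range_K_index: "range (K_index w) = K w"
    and K_index_0: "K_index w 0 = 0"
proof -
  obtain k :: "int \<Rightarrow> int" where "strict_mono k" "range k = K w" "k 0 = 0"
    using enumerate_unbounded_int_set[of "K w"] assms
    by (auto simp: in_collapsibles_iff unbounded_collapsible_iff)
  then show "strict_mono (K_index w)" "range (K_index w) = K w" "K_index w 0 = 0"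
    using K_index_eqI by metis+
qed

lemma K_index_in_K: "w \<in> collapsibles \<Longrightarrow> K_index w i \<in> K w"
  using range_K_index by blast

lemma collapse_Omega: "w \<in> Omega \<Longrightarrow> collapse w \<in> Omega"
  by (simp add: Omega_def collapse_def)

text \<open>Recentring at a kept index translates the enumeration, so collapsing turns the shift by
  \<open>K_index w i\<close> into the shift by \<open>i\<close>.\<close>

lemma collapse_shift:
  assumes "w \<in> collapsibles"
  shows "collapse (shift (K_index w i) w) = shift i (collapse w)"
proof -
  have "K_index (shift (K_index w i) w) = (\<lambda>j. K_index w (j + i) - K_index w i)"
  proof (rule K_index_eqI)
    show "strict_mono (\<lambda>j. K_index w (j + i) - K_index w i)"
      using strict_mono_K_index[OF assms] by (simp add: strict_mono_def)
    show "range (\<lambda>j. K_index w (j + i) - K_index w i) = K (shift (K_index w i) w)"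
    proof (intro equalityI subsetI)
      fix a assume "a \<in> K (shift (K_index w i) w)"
      then have "a + K_index w i \<in> range (K_index w)" by (simp add: K_shift range_K_index[OF assms])
      then obtain j where "K_index w j = a + K_index w i" by (metis rangeE)
      then show "a \<in> range (\<lambda>j. K_index w (j + i) - K_index w i)"
        by (intro range_eqI[of _ _ "j - i"]) simp
    qed (auto simp: K_shift K_index_in_K[OF assms])
  qed simp
  then show ?thesis by (simp add: collapse_def shift_def)
qed

text \<open>The gap to the next kept index is put in the form that
  \<open>lstep_return_horizontal\<close> takes as its hypothesis on rows.\<close>

lemma K_index_neighbour:
  fixes d :: int
  assumes w: "w \<in> collapsibles" and d: "d = 1 \<or> d = -1"
  obtains j where "K_index w (i + d) = K_index w i + d + d * int j"
    "\<And>l. l < j \<Longrightarrow> K_index w i + d + d * int l \<notin> K w"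
proof -
  let ?k = "K_index w"
  note less = strict_mono_less[OF strict_mono_K_index[OF w]]
  define j where "j = nat (d * (?k (i + d) - ?k i) - 1)"
  have pos: "0 < d * (?k (i + d) - ?k i)"
    using d less[of i "i + 1"] less[of "i - 1" i] by auto
  have eq: "?k (i + d) = ?k i + d + d * int j"
    using d pos by (auto simp: j_def)
  have "?k i + d + d * int l \<notin> K w" if l: "l < j" for l
  proof
    assume "?k i + d + d * int l \<in> K w"
    then obtain h where h: "?k h = ?k i + d + d * int l"
      using range_K_index[OF w] by (metis rangeE)
    show False
    proof (cases "d = 1")
      case True
      then have "?k i < ?k h" "?k h < ?k (i + 1)" using h eq l by auto
      then show False by (simp add: less)
    next
      case False
      then have "?k h < ?k i" "?k (i - 1) < ?k h" using h eq l d by auto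
      then show False by (simp add: less)
    qed
  qed
  with eq show ?thesis using that by blast
qed

subsection \<open>Lifted paths\<close>

text \<open>An \<open>lpoint\<close> is a position in \<open>\<int>\<^sup>2\<close> followed by the direction of arrival.\<close>

type_synonym lpoint = "int \<times> int \<times> int \<times> int"

text \<open>Each lattice point carries a mirror: the sign \<open>w m * u n\<close> chooses between
  reflecting the direction in the diagonal and in the antidiagonal. Either one exchanges horizontal
  and vertical, so the two kinds of steps alternate.\<close>

fun lstep :: "sequ \<Rightarrow> sequ \<Rightarrow> lpoint \<Rightarrow> lpoint" where
  "lstep w u (m, n, a, b) =
     (m + w m * u n * b, n + w m * u n * a, w m * u n * b, w m * u n * a)"

fun proj :: "sequ \<Rightarrow> sequ \<Rightarrow> lpoint \<Rightarrow> point" where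
  "proj w u (m, n, v) = (shift m w, shift n u, v)"

fun kept :: "sequ \<Rightarrow> sequ \<Rightarrow> lpoint \<Rightarrow> bool" where
  "kept w u (m, n, v) \<longleftrightarrow> m \<in> K w \<and> n \<in> K u"

text \<open>Reflecting the plane in its main diagonal exchanges the two sequences, so horizontal and
  vertical cases follow from one another.\<close>

fun flip :: "lpoint \<Rightarrow> lpoint" where
  "flip (m, n, a, b) = (n, m, b, a)"

lemma Phi_proj: "Phi (proj w u z) = proj w u (lstep w u z)"
  by (cases z) (simp add: Let_def shift_def algebra_simps)

lemma Phi_pow_proj: "(Phi ^^ t) (proj w u z) = proj w u ((lstep w u ^^ t) z)"
  by (induction t) (simp_all add: Phi_proj)

lemma flip_flip [simp]: "flip (flip z) = z"
  by (cases z) simp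

lemma flip_eq_iff [simp]: "flip y = flip z \<longleftrightarrow> y = z"
  by (metis flip_flip)

lemma lstep_flip: "lstep u w (flip z) = flip (lstep w u z)"
  by (cases z) (simp add: algebra_simps)

lemma lstep_pow_flip: "(lstep u w ^^ t) (flip z) = flip ((lstep w u ^^ t) z)"
  by (induction t) (simp_all add: lstep_flip)

lemma lstep_inj:
  assumes "w \<in> Omega" "u \<in> Omega" "lstep w u y = lstep w u z"
  shows "y = z"
proof -
  obtain m n a b m' n' a' b' where y: "y = (m, n, a, b)" and z: "z = (m', n', a', b')"
    by (metis surj_pair)
  \<comment> \<open>The new position minus the new direction is the old position.\<close>
  have "m = m'" "n = n'" using assms(3) by (auto simp: y z)
  moreover have "w m * u n \<noteq> 0"
    using Omega_cases[OF assms(1), of m] Omega_cases[OF assms(2), of n] by auto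
  ultimately show ?thesis using assms(3) by (auto simp: y z)
qed

lemma kept_flip: "kept u w (flip z) \<longleftrightarrow> kept w u z"
  by (cases z) auto

text \<open>A deleted pair is always met at its near member: sign \<open>d\<close> at
  \<open>n + d\<close> would make \<open>n\<close> its partner, hence deleted with sign
  \<open>- d\<close>, against the hypothesis on \<open>n\<close>. So the partner lies ahead, at
  \<open>n + 2 * d\<close>.\<close>

lemma notin_K_direction:
  assumes u: "u \<in> Omega" and d: "d = 1 \<or> d = -1"
    and n: "n \<in> K u \<or> u n = d" and "n + d \<notin> K u"
  shows "u (n + d) = - d"
proof (rule ccontr)
  assume "u (n + d) \<noteq> - d"
  then have "u (n + d) = d" using Omega_cases[OF u, of "n + d"] d by auto
  with assms(4) have "u n = - d" by (simp add: notin_K_iff[OF u])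
  with n \<open>u (n + d) = d\<close> have "n \<in> K u" using d by auto
  with \<open>u n = - d\<close> \<open>u (n + d) = d\<close> d show False by (simp add: in_K_iff[OF u])
qed

text \<open>A vertical line through a kept column crosses each deleted pair of rows by a detour of four
  steps through the neighbouring column, which has the same sign.\<close>

lemma lstep_detour:
  assumes w: "w \<in> Omega" and u: "u \<in> Omega" and m: "m \<in> K w"
    and d: "d = 1 \<or> d = -1" and n: "u n = - d" "u (n + d) = d"
  shows "(lstep w u ^^ 4) (m, n, 0, d) = (m, n + 2 * d, 0, d)"
    and "s < 4 \<Longrightarrow> \<not> kept w u ((lstep w u ^^ s) (m, n, 0, d))"
proof -
  have m': "w (m - w m) = w m" using m by (simp add: in_K_iff[OF w])
  have nK: "n \<notin> K u" "n + d \<notin> K u" using n d by (auto simp: notin_K_iff[OF u])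
  have e: "w m = 1 \<or> w m = -1" by (rule Omega_cases[OF w])
  have 1: "lstep w u (m, n, 0, d) = (m - w m, n, - w m, 0)"
    using d n by auto
  have 2: "lstep w u (m - w m, n, - w m, 0) = (m - w m, n + d, 0, d)"
    using d n m' e by auto
  have 3: "lstep w u (m - w m, n + d, 0, d) = (m, n + d, w m, 0)"
    using d n m' by auto
  have 4: "lstep w u (m, n + d, w m, 0) = (m, n + 2 * d, 0, d)"
    using d n e by auto
  show "(lstep w u ^^ 4) (m, n, 0, d) = (m, n + 2 * d, 0, d)"
    by (simp add: numeral_eq_Suc 1 2 3 4 del: lstep.simps)
  assume "s < 4"
  then have "s = 0 \<or> s = 1 \<or> s = 2 \<or> s = 3" by auto
  then show "\<not> kept w u ((lstep w u ^^ s) (m, n, 0, d))"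
    using nK 1 2 3 by (auto simp: numeral_eq_Suc simp del: lstep.simps)
qed

text \<open>Induction over the deleted rows ahead, two per detour; \<open>j = 1\<close> would leave
  half a pair. The condition \<open>u n = - d\<close> says that the pair is met at its near row, and
  \<open>notin_K_direction\<close> restores it after each detour.\<close>

lemma lstep_run:
  assumes w: "w \<in> Omega" and u: "u \<in> Omega" and m: "m \<in> K w"
    and d: "d = 1 \<or> d = -1" and n: "n \<in> K u \<or> u n = - d"
    and j: "n + d * int j \<in> K u" "\<And>i. i < j \<Longrightarrow> n + d * int i \<notin> K u"
  shows "\<exists>t. (lstep w u ^^ t) (m, n, 0, d) = (m, n + d * int j, 0, d) \<and>
    (\<forall>s<t. \<not> kept w u ((lstep w u ^^ s) (m, n, 0, d)))"
  using n j
proof (induction j arbitrary: n rule: less_induct)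
  case (less j)
  show ?case
  proof (cases "j = 0")
    case True
    then show ?thesis by (intro exI[of _ 0]) simp
  next
    case False
    then have nK: "n \<notin> K u" using less.prems(3)[of 0] by simp
    then have un: "u n = - d" using less.prems(1) by simp
    then have und: "u (n + d) = d" using nK by (simp add: notin_K_iff[OF u])
    have "n + d \<notin> K u" using un und d by (auto simp: notin_K_iff[OF u])
    then have "j \<noteq> 1" using less.prems(2) by auto
    then obtain j' where j': "j = j' + 2" using False by (metis One_nat_def add_2_eq_Suc' not0_implies_Suc)
    have "n + 2 * d \<in> K u \<or> u (n + 2 * d) = - d"
      using notin_K_direction[OF u d, of "n + d"] und by (auto simp: algebra_simps)
    then obtain t where t: "(lstep w u ^^ t) (m, n + 2 * d, 0, d) = (m, n + 2 * d + d * int j', 0, d)"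
      "\<And>s. s < t \<Longrightarrow> \<not> kept w u ((lstep w u ^^ s) (m, n + 2 * d, 0, d))"
      using less.IH[of j' "n + 2 * d"] less.prems(2) less.prems(3)[of "_ + 2"] j'
      by (auto simp: algebra_simps)
    note det = lstep_detour[OF w u m d un und]
    show ?thesis
    proof (intro exI[of _ "t + 4"] conjI allI impI)
      show "(lstep w u ^^ (t + 4)) (m, n, 0, d) = (m, n + d * int j, 0, d)"
        using t(1) by (simp add: funpow_add det(1) j' algebra_simps del: lstep.simps)
      fix s assume s: "s < t + 4"
      show "\<not> kept w u ((lstep w u ^^ s) (m, n, 0, d))"
      proof (cases "s < 4")
        case False
        then obtain s' where "s = s' + 4" by (metis add.commute le_Suc_ex not_less)
        then show ?thesis using t(2)[of s'] s by (simp add: funpow_add det(1) del: lstep.simps)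
      qed (rule det(2))
    qed
  qed
qed

text \<open>The mirror turns the path into column \<open>m\<close>, and \<open>lstep_run\<close>
  carries it to the next kept row. The alternative \<open>u n = d\<close> admits a start in a
  deleted row that is left away from its partner; \<open>settles_kept_col\<close> uses it.\<close>

lemma lstep_return_horizontal:
  assumes w: "w \<in> Omega" and u: "u \<in> Omega" and m: "m \<in> K w"
    and a: "a = 1 \<or> a = -1" and d: "d = w m * u n * a" and n: "n \<in> K u \<or> u n = d"
    and j: "n + d + d * int j \<in> K u" "\<And>i. i < j \<Longrightarrow> n + d + d * int i \<notin> K u"
  shows "\<exists>t>0. (lstep w u ^^ t) (m, n, a, 0) = (m, n + d + d * int j, 0, d) \<and>
    (\<forall>s. 0 < s \<longrightarrow> s < t \<longrightarrow> \<not> kept w u ((lstep w u ^^ s) (m, n, a, 0)))"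
proof -
  have d1: "d = 1 \<or> d = -1" using a d Omega_cases[OF w, of m] Omega_cases[OF u, of n] by auto
  have step: "lstep w u (m, n, a, 0) = (m, n + d, 0, d)" by (simp add: d)
  have "n + d \<in> K u \<or> u (n + d) = - d" using notin_K_direction[OF u d1 n] by blast
  from lstep_run[OF w u m d1 this j]
  obtain t where t: "(lstep w u ^^ t) (m, n + d, 0, d) = (m, n + d + d * int j, 0, d)"
    "\<And>s. s < t \<Longrightarrow> \<not> kept w u ((lstep w u ^^ s) (m, n + d, 0, d))" by blast
  have sh: "(lstep w u ^^ Suc s) (m, n, a, 0) = (lstep w u ^^ s) (m, n + d, 0, d)" for s
    by (simp only: funpow_Suc_right comp_apply step)
  show ?thesis
  proof (intro exI[of _ "Suc t"] conjI allI impI)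
    show "(lstep w u ^^ Suc t) (m, n, a, 0) = (m, n + d + d * int j, 0, d)"
      unfolding sh by (rule t(1))
    fix s :: nat assume "0 < s" "s < Suc t"
    then show "\<not> kept w u ((lstep w u ^^ s) (m, n, a, 0))"
      using t(2)[of "s - 1"] sh[of "s - 1"] by simp
  qed simp
qed

lemma lstep_escape_horizontal:
  assumes w: "w \<in> Omega" and u: "u \<in> Omega" and m: "m \<in> K w"
    and a: "a = 1 \<or> a = -1" and n: "n \<in> K u \<or> u n = w m * u n * a"
    and unb: "unbounded_collapsible u"
  shows "\<exists>t>0. kept w u ((lstep w u ^^ t) (m, n, a, 0))"
proof -
  define d where "d = w m * u n * a"
  have d1: "d = 1 \<or> d = -1"
    using a Omega_cases[OF w, of m] Omega_cases[OF u, of n] by (auto simp: d_def)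
  obtain j where j: "n + d + d * int j \<in> K u" "\<And>i. i < j \<Longrightarrow> n + d + d * int i \<notin> K u"
    using unbounded_collapsible_next[OF unb d1, of "n + d"] by metis
  from lstep_return_horizontal[OF w u m a d_def _ j] n[folded d_def]
  show ?thesis using m j(1) by (metis kept.simps)
qed

subsection \<open>Four-cycles\<close>

text \<open>The dichotomy that is to be shown when both sequences are unbounded-collapsible: a kept
  crossing lies ahead, or the path closes up.\<close>

definition settles :: "sequ \<Rightarrow> sequ \<Rightarrow> lpoint \<Rightarrow> bool" where
  "settles w u z \<longleftrightarrow> (\<exists>t. kept w u ((lstep w u ^^ t) z)) \<or> (\<exists>L>0. (lstep w u ^^ L) z = z)"

lemma settles_flip: "settles u w (flip z) \<longleftrightarrow> settles w u z"
  by (simp add: settles_def lstep_pow_flip kept_flip)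

lemma settles_keptI: "kept w u ((lstep w u ^^ t) z) \<Longrightarrow> settles w u z"
  by (auto simp: settles_def)

text \<open>If \<open>z\<close> were kept, time 0 could be its only kept visit, and nothing would
  follow for the next point.\<close>

lemma settles_lstepI:
  assumes "settles w u z" "\<not> kept w u z"
  shows "settles w u (lstep w u z)"
  using assms(1) unfolding settles_def
proof (elim disjE exE conjE)
  fix t assume t: "kept w u ((lstep w u ^^ t) z)"
  then obtain s where "t = Suc s" using assms(2) by (cases t) auto
  with t have "kept w u ((lstep w u ^^ s) (lstep w u z))" by (simp add: funpow_swap1)
  then show "(\<exists>t. kept w u ((lstep w u ^^ t) (lstep w u z))) \<or>
    (\<exists>L>0. (lstep w u ^^ L) (lstep w u z) = lstep w u z)" by blast
next
  fix L :: nat assume "L > 0" "(lstep w u ^^ L) z = z"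
  then show "(\<exists>t. kept w u ((lstep w u ^^ t) (lstep w u z))) \<or>
    (\<exists>L>0. (lstep w u ^^ L) (lstep w u z) = lstep w u z)" by (metis funpow_swap1)
qed

text \<open>A cycle through \<open>lstep w u z\<close> passes through \<open>z\<close> because
  \<open>lstep\<close> is injective.\<close>

lemma settles_lstepD:
  assumes "w \<in> Omega" "u \<in> Omega" "settles w u (lstep w u z)"
  shows "settles w u z"
  using assms(3) unfolding settles_def
  by (metis funpow_swap1 lstep_inj[OF assms(1,2)] comp_apply funpow.simps(2))

lemma four_cycle:
  assumes "lstep w u z1 = z2" "lstep w u z2 = z3" "lstep w u z3 = z4" "lstep w u z4 = z1"
  shows "settles w u z1"
proof -
  have "(lstep w u ^^ 4) z1 = z1" by (simp add: numeral_eq_Suc assms)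
  then show ?thesis unfolding settles_def by (metis zero_less_numeral)
qed

text \<open>If the mirror sends the path away from the partner row, it runs along the column to a
  kept crossing. Otherwise it enters the partner row and turns to the column \<open>m + w m\<close>.
  A sign equal to \<open>w m\<close> makes that column kept, and the path escapes along it; the
  opposite sign closes a four-cycle around a unit square.\<close>

lemma settles_kept_col:
  assumes w: "w \<in> Omega" and u: "u \<in> Omega" and m: "m \<in> K w" and n: "n \<notin> K u"
    and a: "a = 1 \<or> a = -1" and unb: "unbounded_collapsible u"
  shows "settles w u (m, n, a, 0)"
proof (cases "w m * u n * a = u n")
  case True
  then show ?thesis
    using lstep_escape_horizontal[OF w u m a _ unb] by (auto intro: settles_keptI simp del: lstep.simps)
next
  case False
  have e: "w m = 1 \<or> w m = -1" and f: "u n = 1 \<or> u n = -1"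
    by (rule Omega_cases[OF w] Omega_cases[OF u])+
  have a': "a = - w m" using False e f a by auto
  define n' where "n' = n - u n"
  have un': "u n' = - u n" using n by (simp add: n'_def notin_K_iff[OF u])
  have 1: "lstep w u (m, n, a, 0) = (m, n', 0, - u n)"
    using a' e by (auto simp: n'_def)
  have 2: "lstep w u (m, n', 0, - u n) = (m + w m, n', w m, 0)"
    using un' f by auto
  show ?thesis
  proof (cases "w (m + w m) = w m")
    case True
    have mK: "m + w m \<in> K w" using True e by (auto simp: in_K_iff[OF w])
    have "\<exists>t>0. kept w u ((lstep w u ^^ t) (m + w m, n', w m, 0))"
      by (rule lstep_escape_horizontal[OF w u mK _ _ unb]) (use True e in auto)
    then obtain t where "kept w u ((lstep w u ^^ t) (lstep w u (lstep w u (m, n, a, 0))))"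
      unfolding 1 2 by blast
    then have "kept w u ((lstep w u ^^ (Suc (Suc t))) (m, n, a, 0))"
      by (simp only: funpow_Suc_right comp_apply)
    then show ?thesis by (rule settles_keptI)
  next
    case False
    then have wm: "w (m + w m) = - w m" using e Omega_cases[OF w, of "m + w m"] by auto
    have 3: "lstep w u (m + w m, n', w m, 0) = (m + w m, n, 0, u n)"
      using e wm un' by (auto simp: n'_def)
    have 4: "lstep w u (m + w m, n, 0, u n) = (m, n, a, 0)"
      using f wm a' by auto
    show ?thesis by (rule four_cycle[OF 1 2 3 4])
  qed
qed

lemma settles_kept_row:
  assumes w: "w \<in> Omega" and u: "u \<in> Omega" and m: "m \<notin> K w" and n: "n \<in> K u"
    and b: "b = 1 \<or> b = -1" and unb: "unbounded_collapsible w"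
  shows "settles w u (m, n, 0, b)"
  using settles_kept_col[OF u w n m b unb] settles_flip[of u w "(m, n, 0, b)"] by simp

text \<open>One step earlier the path was in the same row, arriving vertically in column
  \<open>m - a\<close>. If that column is kept, the escape from it takes a positive number of steps
  and so passes through the present point; if it is deleted, \<open>settles_kept_row\<close> applies
  there.\<close>

lemma settles_kept_row_horizontal:
  assumes w: "w \<in> Omega" and u: "u \<in> Omega" and m: "m \<notin> K w" and n: "n \<in> K u"
    and a: "a = 1 \<or> a = -1" and unb: "unbounded_collapsible w"
  shows "settles w u (m, n, a, 0)"
proof -
  define b where "b = w (m - a) * u n * a"
  have e: "w (m - a) = 1 \<or> w (m - a) = -1" and f: "u n = 1 \<or> u n = -1"
    by (rule Omega_cases[OF w] Omega_cases[OF u])+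
  have b: "b = 1 \<or> b = -1" using e f a by (auto simp: b_def)
  have step: "lstep w u (m - a, n, 0, b) = (m, n, a, 0)"
    using e f by (auto simp: b_def)
  show ?thesis
  proof (cases "m - a \<in> K w")
    case True
    from lstep_escape_horizontal[OF u w n b _ unb] True
    obtain t where t: "t > 0" "kept u w ((lstep u w ^^ t) (n, m - a, b, 0))" by blast
    then have "kept w u ((lstep w u ^^ t) (m - a, n, 0, b))"
      using lstep_pow_flip[where w = u and u = w and z = "(n, m - a, b, 0)"] by (metis flip.simps kept_flip)
    then have "kept w u ((lstep w u ^^ (t - 1)) (lstep w u (m - a, n, 0, b)))"
      using t(1) by (metis Suc_diff_1 comp_apply funpow_Suc_right)
    then show ?thesis unfolding step by (rule settles_keptI)
  next
    case False
    then show ?thesis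
      using settles_lstepI[OF settles_kept_row[OF w u False n b unb]] step by simp
  qed
qed

text \<open>The direction \<open>a = w m\<close> points away from the partner column
  \<open>m - w m\<close>, and the path leaves away from the partner row as well. If the next row is
  deleted too, it starts another pair and has sign \<open>- u n\<close>; then the mirrors in columns
  \<open>m\<close>, \<open>m - w m\<close> and rows \<open>n\<close>, \<open>n + u n\<close> close
  the path.\<close>

lemma settles_deleted_outward:
  assumes w: "w \<in> Omega" and u: "u \<in> Omega" and m: "m \<notin> K w" and n: "n \<notin> K u"
    and a: "a = w m" and unb: "unbounded_collapsible w"
  shows "settles w u (m, n, a, 0)"
proof -
  have e: "w m = 1 \<or> w m = -1" and f: "u n = 1 \<or> u n = -1"
    by (rule Omega_cases[OF w] Omega_cases[OF u])+
  have 1: "lstep w u (m, n, a, 0) = (m, n + u n, 0, u n)"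
    using a e by auto
  show ?thesis
  proof (cases "n + u n \<in> K u")
    case True
    have "settles w u (m, n + u n, 0, u n)" by (rule settles_kept_row[OF w u m True f unb])
    then show ?thesis unfolding 1[symmetric] by (rule settles_lstepD[OF w u])
  next
    case False
    have un: "u (n + u n) = - u n" by (rule notin_K_direction[OF u f _ False]) simp
    have wm: "w (m - w m) = - w m" using m by (simp add: notin_K_iff[OF w])
    have 2: "lstep w u (m, n + u n, 0, u n) = (m - w m, n + u n, - w m, 0)"
      using un f by auto
    have 3: "lstep w u (m - w m, n + u n, - w m, 0) = (m - w m, n, 0, - u n)"
      using un wm e by auto
    have 4: "lstep w u (m - w m, n, 0, - u n) = (m, n, a, 0)"
      using f wm a by auto
    show ?thesis by (rule four_cycle[OF 1 2 3 4])
  qed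
qed

lemma settles_horizontal:
  assumes w: "w \<in> Omega" and u: "u \<in> Omega" and a: "a = 1 \<or> a = -1"
    and unb: "unbounded_collapsible w" "unbounded_collapsible u"
  shows "settles w u (m, n, a, 0)"
proof -
  consider "m \<in> K w" "n \<in> K u" | "m \<in> K w" "n \<notin> K u" | "m \<notin> K w" "n \<in> K u" | "m \<notin> K w" "n \<notin> K u"
    by blast
  then show ?thesis
  proof cases
    case 1
    then show ?thesis by (intro settles_keptI[of _ _ 0]) simp
  next
    case 2
    then show ?thesis by (intro settles_kept_col assms)
  next
    case 3
    then show ?thesis by (intro settles_kept_row_horizontal assms)
  next
    case 4
    have e: "w m = 1 \<or> w m = -1" and f: "u n = 1 \<or> u n = -1"
      by (rule Omega_cases[OF w] Omega_cases[OF u])+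
    show ?thesis
    proof (cases "a = w m")
      case True
      with 4 show ?thesis by (intro settles_deleted_outward assms)
    next
      case False
      \<comment> \<open>The path is turned into the partner row, in a direction equal to the sign of
        that row. Reflected in the diagonal, this is the outward case.\<close>
      then have a': "a = - w m" using a e by auto
      have un: "u (n - u n) = - u n" using 4 by (simp add: notin_K_iff[OF u])
      have nK: "n - u n \<notin> K u" using un by (simp add: notin_K_iff[OF u])
      have step: "lstep w u (m, n, a, 0) = flip (n - u n, m, - u n, 0)"
        using a' e by auto
      have "settles u w (n - u n, m, - u n, 0)"
        by (rule settles_deleted_outward[OF u w nK 4(1) _ unb(2)]) (simp add: un)
      then show ?thesis
        using settles_lstepD[OF w u] settles_flip step by metis
    qed
  qed
qed

lemma settles_all:
  assumes w: "w \<in> Omega" and u: "u \<in> Omega" and v: "v \<in> N"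
    and unb: "unbounded_collapsible w" "unbounded_collapsible u"
  shows "settles w u (m, n, v)"
proof -
  consider a where "v = (a, 0)" "a = 1 \<or> a = -1" | b where "v = (0, b)" "b = 1 \<or> b = -1"
    using v by (auto simp: N_def)
  then show ?thesis
  proof cases
    case 1
    then show ?thesis using settles_horizontal[OF w u] unb by simp
  next
    case 2
    then show ?thesis
      using settles_horizontal[OF u w, of b n m] settles_flip[of u w "(m, n, 0, b)"] unb by simp
  qed
qed

subsection \<open>The collapsed path\<close>

fun emb :: "sequ \<Rightarrow> sequ \<Rightarrow> lpoint \<Rightarrow> lpoint" where
  "emb w u (i, j, v) = (K_index w i, K_index u j, v)"

lemma lstep_N: "w \<in> Omega \<Longrightarrow> u \<in> Omega \<Longrightarrow> snd (snd z) \<in> N \<Longrightarrow> snd (snd (lstep w u z)) \<in> N"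
  using Omega_cases[of w "fst z"] Omega_cases[of u "fst (snd z)"] by (cases z) (auto simp: N_def)

lemma lstep_pow_N:
  "w \<in> Omega \<Longrightarrow> u \<in> Omega \<Longrightarrow> snd (snd z) \<in> N \<Longrightarrow> snd (snd ((lstep w u ^^ t) z)) \<in> N"
  by (induction t) (simp_all add: lstep_N)

lemma kept_iff_emb:
  assumes "w \<in> collapsibles" "u \<in> collapsibles"
  shows "kept w u z \<longleftrightarrow> z \<in> range (emb w u)"
proof (cases z)
  case (fields m n a b)
  show ?thesis
  proof
    assume "kept w u z"
    then obtain i j where "m = K_index w i" "n = K_index u j"
      using fields assms by (auto simp: range_K_index[symmetric])
    then have "z = emb w u (i, j, a, b)" by (simp add: fields)
    then show "z \<in> range (emb w u)" by blast
  next
    assume "z \<in> range (emb w u)"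
    then obtain y where "z = emb w u y" by blast
    then show "kept w u z" by (cases y) (simp add: K_index_in_K assms)
  qed
qed

lemma emb_inj:
  assumes "w \<in> collapsibles" "u \<in> collapsibles" "emb w u y = emb w u z"
  shows "y = z"
  using assms(3) strict_mono_eq[OF strict_mono_K_index[OF assms(1)]]
    strict_mono_eq[OF strict_mono_K_index[OF assms(2)]]
  by (cases y; cases z) simp

text \<open>The mirror at the embedded crossing has the same sign as the collapsed one, so both
  paths leave in direction \<open>d\<close>, and the next kept row that way is
  \<open>K_index u (j + d)\<close>.\<close>

lemma lstep_emb_horizontal:
  assumes w: "w \<in> collapsibles" and u: "u \<in> collapsibles" and a: "a = 1 \<or> a = -1"
  shows "\<exists>t>0. (lstep w u ^^ t) (emb w u (i, j, a, 0)) =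
      emb w u (lstep (collapse w) (collapse u) (i, j, a, 0)) \<and>
    (\<forall>s. 0 < s \<longrightarrow> s < t \<longrightarrow> \<not> kept w u ((lstep w u ^^ s) (emb w u (i, j, a, 0))))"
proof -
  have wO: "w \<in> Omega" and uO: "u \<in> Omega" using w u by (auto simp: in_collapsibles_iff)
  define d where "d = w (K_index w i) * u (K_index u j) * a"
  have d1: "d = 1 \<or> d = -1"
    using a Omega_cases[OF wO, of "K_index w i"] Omega_cases[OF uO, of "K_index u j"] by (auto simp: d_def)
  obtain l where l: "K_index u (j + d) = K_index u j + d + d * int l"
    "\<And>h. h < l \<Longrightarrow> K_index u j + d + d * int h \<notin> K u"
    using K_index_neighbour[OF u d1, of j] by metis
  have eq: "emb w u (lstep (collapse w) (collapse u) (i, j, a, 0)) =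
      (K_index w i, K_index u j + d + d * int l, 0, d)"
    by (simp add: collapse_def flip: d_def l(1))
  show ?thesis
    unfolding eq unfolding emb.simps
    by (rule lstep_return_horizontal[OF wO uO K_index_in_K[OF w] a d_def _ _ l(2)])
      (auto simp: K_index_in_K[OF u] simp flip: l(1))
qed

lemma emb_flip: "emb u w (flip z) = flip (emb w u z)"
  by (cases z) simp

lemma lstep_emb:
  assumes w: "w \<in> collapsibles" and u: "u \<in> collapsibles" and v: "snd (snd z) \<in> N"
  shows "\<exists>t>0. (lstep w u ^^ t) (emb w u z) = emb w u (lstep (collapse w) (collapse u) z) \<and>
    (\<forall>s. 0 < s \<longrightarrow> s < t \<longrightarrow> \<not> kept w u ((lstep w u ^^ s) (emb w u z)))"
proof -
  consider i j a where "z = (i, j, a, 0)" "a = 1 \<or> a = -1"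
    | i j b where "z = flip (j, i, b, 0)" "b = 1 \<or> b = -1"
    using v by (cases z) (auto simp: N_def)
  then show ?thesis
  proof cases
    case 1
    then show ?thesis using lstep_emb_horizontal[OF w u] by simp
  next
    case 2
    show ?thesis
      unfolding 2(1) lstep_flip emb_flip lstep_pow_flip flip_eq_iff kept_flip
      by (rule lstep_emb_horizontal[OF u w 2(2)])
  qed
qed

text \<open>Iterates the first return. Every return takes at least one step, whence
  \<open>t \<ge> L\<close>; a positive collapsed period thus yields a positive period.\<close>

lemma lstep_emb_pow:
  assumes w: "w \<in> collapsibles" and u: "u \<in> collapsibles" and v: "snd (snd z) \<in> N"
  shows "\<exists>t\<ge>L. (lstep w u ^^ t) (emb w u z) = emb w u ((lstep (collapse w) (collapse u) ^^ L) z)"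
proof (induction L)
  case (Suc L)
  let ?y = "(lstep (collapse w) (collapse u) ^^ L) z"
  obtain t where t: "t \<ge> L" "(lstep w u ^^ t) (emb w u z) = emb w u ?y" using Suc by blast
  have "snd (snd ?y) \<in> N"
    using w u v by (intro lstep_pow_N collapse_Omega) (auto simp: in_collapsibles_iff)
  from lstep_emb[OF w u this] obtain s where "s > 0"
    "(lstep w u ^^ s) (emb w u ?y) = emb w u (lstep (collapse w) (collapse u) ?y)" by blast
  with t show ?case by (intro exI[of _ "s + t"]) (auto simp: funpow_add)
qed (auto intro: exI[of _ 0])

text \<open>Cutting the path at its kept visits makes \<open>M\<close> the number of returns up to
  time \<open>L\<close>. Equality \<open>M = L\<close> forces every return to take a single step, so
  all crossings met are kept; on a closed path \<open>no_kept_cycle\<close> excludes this.\<close>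

lemma lstep_emb_visit:
  assumes w: "w \<in> collapsibles" and u: "u \<in> collapsibles" and v: "snd (snd z) \<in> N"
    and "kept w u ((lstep w u ^^ L) (emb w u z))"
  shows "\<exists>M\<le>L. (lstep w u ^^ L) (emb w u z) = emb w u ((lstep (collapse w) (collapse u) ^^ M) z)
    \<and> (0 < L \<longrightarrow> 0 < M) \<and> (M = L \<longrightarrow> (\<forall>s\<le>L. kept w u ((lstep w u ^^ s) (emb w u z))))"
  using v assms(4)
proof (induction L arbitrary: z rule: less_induct)
  case (less L)
  let ?f = "lstep w u" and ?g = "lstep (collapse w) (collapse u)"
  have k0: "kept w u (emb w u z)" by (simp add: kept_iff_emb[OF w u])
  show ?case
  proof (cases "L = 0")
    case True
    with k0 show ?thesis by (intro exI[of _ 0]) auto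
  next
    case False
    obtain t where t: "t > 0" "(?f ^^ t) (emb w u z) = emb w u (?g z)"
      "\<And>s. 0 < s \<Longrightarrow> s < t \<Longrightarrow> \<not> kept w u ((?f ^^ s) (emb w u z))"
      using lstep_emb[OF w u less.prems(1)] by blast
    have tL: "t \<le> L" using t(3)[of L] less.prems(2) False by (meson not_le gr0I)
    have add: "(?f ^^ (r + t)) (emb w u z) = (?f ^^ r) (emb w u (?g z))" for r
      by (simp add: funpow_add t(2))
    have vg: "snd (snd (?g z)) \<in> N"
      using w u less.prems(1) by (intro lstep_N collapse_Omega) (auto simp: in_collapsibles_iff)
    obtain M where M: "M \<le> L - t" "(?f ^^ (L - t)) (emb w u (?g z)) = emb w u ((?g ^^ M) (?g z))"
      "M = L - t \<Longrightarrow> \<forall>s\<le>L - t. kept w u ((?f ^^ s) (emb w u (?g z)))"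
      using less.IH[OF _ vg, of "L - t"] add[of "L - t"] less.prems(2) t(1) tL False by auto
    show ?thesis
    proof (intro exI[of _ "Suc M"] conjI impI)
      show "Suc M \<le> L" using M(1) t(1) tL by linarith
      show "(?f ^^ L) (emb w u z) = emb w u ((?g ^^ Suc M) z)"
        using add[of "L - t"] tL M(2) by (simp add: funpow_swap1)
      assume eq: "Suc M = L"
      then have t1: "t = 1" and M_eq: "M = L - t" using M(1) t(1) tL by linarith+
      show "\<forall>s\<le>L. kept w u ((?f ^^ s) (emb w u z))"
      proof (intro allI impI)
        fix s assume "s \<le> L"
        then show "kept w u ((?f ^^ s) (emb w u z))"
          using k0 add[of "s - 1"] M(3)[OF M_eq] t1 by (cases s) auto
      qed
    qed simp
  qed
qed

text \<open>At a topmost row of such a cycle the sign of the row is \<open>+1\<close>, and, since no visited row is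
  deleted, the same holds for all visited rows. Then all horizontal steps go the same way.\<close>

lemma no_kept_cycle_vertical:
  assumes w: "w \<in> Omega" and u: "u \<in> Omega" and L: "0 < L"
    and b0: "b0 = 1 \<or> b0 = -1" and per: "(lstep w u ^^ L) (m0, n0, 0, b0) = (m0, n0, 0, b0)"
    and kept: "\<And>s. kept w u ((lstep w u ^^ s) (m0, n0, 0, b0))"
  shows False
proof -
  \<comment> \<open>Only every second state is used, so that all arrivals are vertical. Advancing
    the index by \<open>L\<close> runs through two full periods.\<close>
  define z where "z j = (lstep w u ^^ (2 * j)) (m0, n0, 0, b0)" for j
  define row where "row j = fst (snd (z j))" for j
  have z_Suc: "z (Suc j) = lstep w u (lstep w u (z j))" for j
    by (simp add: z_def)
  have two: "lstep w u (lstep w u (m, n, 0, b)) =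
      (m + w m * u n * b, n + w (m + w m * u n * b) * u n * (w m * u n * b), 0,
       w (m + w m * u n * b) * u n * (w m * u n * b))" for m n b
    by simp
  have z_form: "\<exists>m n b. z j = (m, n, 0, b) \<and> (b = 1 \<or> b = -1)" for j
  proof (induction j)
    case 0
    then show ?case using b0 by (simp add: z_def)
  next
    case (Suc j)
    then obtain m n b where mnb: "z j = (m, n, 0, b)" "b = 1 \<or> b = -1" by blast
    have "w (m + w m * u n * b) * u n * (w m * u n * b) \<in> {1, -1}"
      using mnb(2) Omega_cases[OF w, of m] Omega_cases[OF u, of n]
        Omega_cases[OF w, of "m + w m * u n * b"] by auto
    then show ?case unfolding z_Suc mnb(1) two by blast
  qed
  have z_per: "z (j + L) = z j" for j
    using per by (simp add: z_def distrib_left funpow_add mult_2)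
  have z_mod: "z (j mod L) = z j" for j
  proof (induction j rule: less_induct)
    case (less j)
    show ?case
    proof (cases "j < L")
      case False
      then have "z ((j - L) mod L) = z (j - L)" using less L by simp
      then show ?thesis using False z_per[of "j - L"] by (simp add: le_mod_geq)
    qed simp
  qed
  have fin: "finite (range row)"
  proof (rule finite_subset)
    show "range row \<subseteq> row ` {..<L}"
      using L z_mod by (metis (no_types, lifting) image_eqI image_subsetI lessThan_iff mod_less_divisor row_def)
  qed simp
  obtain i where i: "\<And>j. row j \<le> row i"
  proof -
    have "Max (range row) \<in> range row" using fin by (intro Max_in) auto
    then obtain i where "row i = Max (range row)" by (metis rangeE)
    then show ?thesis using that[of i] Max_ge[OF fin] by simp
  qed
  obtain m n b where zi: "z i = (m, n, 0, b)" "b = 1 \<or> b = -1" using z_form by blast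
  have rowi: "row i = n" by (simp add: row_def zi)
  have kz: "kept w u (z j)" for j unfolding z_def by (rule kept)
  have "m \<in> K w" using kz[of i] by (simp add: zi)
  \<comment> \<open>The preceding vertical arrival was in row \<open>n - b\<close>, and no row
    exceeds \<open>n\<close>. The index \<open>i + L - 1\<close> reaches that arrival even when
    \<open>i = 0\<close>.\<close>
  have b: "b = 1"
  proof -
    obtain m' n' b' where z': "z (i + L - 1) = (m', n', 0, b')" using z_form by blast
    have "z i = lstep w u (lstep w u (z (i + L - 1)))"
      using z_Suc[of "i + L - 1"] z_per[of i] L by simp
    then have "n = n' + b" using zi unfolding z' two by auto
    moreover have "n' \<le> n" using i[of "i + L - 1", unfolded rowi] by (simp only: row_def z' fst_conv snd_conv)
    ultimately show ?thesis using zi(2) by auto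
  qed
  define e where "e = w m"
  have e: "e = 1 \<or> e = -1" unfolding e_def by (rule Omega_cases[OF w])
  \<comment> \<open>With sign -1 the path would turn to column \<open>m - w m\<close>, of equal sign
    because \<open>m\<close> is kept, and from there rise to row \<open>n + 1\<close>.\<close>
  have un: "u n = 1"
  proof (rule ccontr)
    assume "u n \<noteq> 1"
    then have un: "u n = -1" using Omega_cases[OF u, of n] by auto
    have "w (m - e) = e" using \<open>m \<in> K w\<close> by (simp add: in_K_iff[OF w] e_def)
    then have "z (Suc i) = (m - e, n + 1, 0, 1)"
      unfolding z_Suc zi(1) two using e un by (auto simp: b simp flip: e_def)
    then show False using i[of "Suc i", unfolded rowi] by (simp add: row_def)
  qed
  \<comment> \<open>Row sign 1 together with \<open>w (m + int j * e) * b' = e\<close> makes the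
    next horizontal step equal to \<open>e\<close>. A new lowest row \<open>n' - 1\<close> again has
    sign 1, because row \<open>n'\<close> has sign 1 and is kept.\<close>
  have inv: "\<exists>n' b'. z (i + j) = (m + int j * e, n', 0, b') \<and> n' \<le> n \<and>
      w (m + int j * e) * b' = e \<and> (\<forall>k. n' \<le> k \<longrightarrow> k \<le> n \<longrightarrow> u k = 1)" for j
  proof (induction j)
    case 0
    have "u k = 1" if "n \<le> k" "k \<le> n" for k using un that by (metis order_antisym)
    then show ?case by (simp add: zi b e_def)
  next
    case (Suc j)
    then obtain n' b' where I: "z (i + j) = (m + int j * e, n', 0, b')" "n' \<le> n"
      "w (m + int j * e) * b' = e" "\<And>k. n' \<le> k \<Longrightarrow> k \<le> n \<Longrightarrow> u k = 1" by blast
    have u1: "u n' = 1" using I by simp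
    define d where "d = w (m + int j * e + e) * e"
    have a: "w (m + int j * e) * u n' * b' = e" using I(3) u1 by simp
    have z: "z (Suc (i + j)) = (m + int j * e + e, n' + d, 0, d)"
      unfolding z_Suc I(1) two a by (simp add: u1 d_def)
    have d: "d = 1 \<or> d = -1"
      using e Omega_cases[OF w, of "m + int j * e + e"] by (auto simp: d_def)
    have "n' + d \<le> n" using i[of "Suc (i + j)", unfolded rowi] by (simp add: row_def z)
    moreover have "w (m + int j * e + e) * d = e"
      using Omega_cases[OF w, of "m + int j * e + e"] by (auto simp: d_def)
    moreover have "u k = 1" if k: "n' + d \<le> k" "k \<le> n" for k
    proof (cases "n' \<le> k")
      case False
      then have "k = n' - 1" using k(1) d by auto
      moreover have "n' \<in> K u" using kz[of "i + j"] by (simp add: I(1))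
      ultimately show ?thesis using u1 by (simp add: in_K_iff[OF u])
    qed (use I(4) k in blast)
    ultimately show ?case using z by (auto simp: algebra_simps)
  qed
  \<comment> \<open>A horizontal displacement of \<open>int L * e\<close> contradicts the period
    \<open>L\<close>.\<close>
  obtain n' b' where "z (i + L) = (m + int L * e, n', 0, b')" using inv by blast
  then show False using z_per[of i] zi(1) L e by auto
qed

lemma no_kept_cycle:
  assumes w: "w \<in> Omega" and u: "u \<in> Omega" and L: "0 < L" and v: "snd (snd z) \<in> N"
    and per: "(lstep w u ^^ L) z = z"
  shows "\<exists>s\<le>L. \<not> kept w u ((lstep w u ^^ s) z)"
proof (rule ccontr)
  assume "\<not> ?thesis"
  then have "kept w u ((lstep w u ^^ (s mod L)) z)" for s
    using L by (meson less_imp_le mod_less_divisor)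
  then have kept: "kept w u ((lstep w u ^^ s) z)" for s
    using funpow_mod_eq[OF per] by metis
  consider m n b where "z = (m, n, 0, b)" "b = 1 \<or> b = -1"
    | m n a where "z = (m, n, a, 0)" "a = 1 \<or> a = -1"
    using v by (cases z) (auto simp: N_def)
  then show False
  proof cases
    case 1
    then show False using no_kept_cycle_vertical[OF w u L 1(2)] per kept by blast
  next
    case 2
    define b where "b = w m * u n * a"
    have b: "b = 1 \<or> b = -1"
      using 2(2) Omega_cases[OF w, of m] Omega_cases[OF u, of n] by (auto simp: b_def)
    have z': "lstep w u z = (m, n + b, 0, b)" by (simp add: 2 b_def)
    show False
    proof (rule no_kept_cycle_vertical[OF w u L b])
      show "(lstep w u ^^ L) (m, n + b, 0, b) = (m, n + b, 0, b)"
        unfolding z'[symmetric] funpow_swap1[symmetric] per ..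
      show "kept w u ((lstep w u ^^ s) (m, n + b, 0, b))" for s
        using kept[of "Suc s"] unfolding z'[symmetric] by (simp add: funpow_swap1)
    qed
  qed
qed

subsection \<open>Periodicity under renormalization\<close>

text \<open>The lift must come back to the origin itself, not only to a point with the same
  surroundings. \<open>L\<close> need not be minimal.\<close>

fun closes :: "nat \<Rightarrow> point \<Rightarrow> bool" where
  "closes L (w, u, v) \<longleftrightarrow> 0 < L \<and> (lstep w u ^^ L) (0, 0, v) = (0, 0, v)"

lemma proj_0: "(w, u, v) = proj w u (0, 0, v)"
  by simp

lemma lstep_shift_pow:
  "(lstep (shift p w) (shift q u) ^^ t) (m, n, v) =
    (\<lambda>(m', n', v'). (m' - p, n' - q, v')) ((lstep w u ^^ t) (m + p, n + q, v))"
proof (induction t)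
  case (Suc t)
  obtain m' n' a b where "(lstep w u ^^ t) (m + p, n + q, v) = (m', n', a, b)" by (metis surj_pair)
  with Suc show ?case by (simp add: shift_def)
qed simp

lemma closes_proj: "closes L (proj w u z) \<longleftrightarrow> 0 < L \<and> (lstep w u ^^ L) z = z"
proof (cases z)
  case (fields m n a b)
  obtain m' n' v where "(lstep w u ^^ L) z = (m', n', v)" by (metis surj_pair)
  then show ?thesis using lstep_shift_pow[of L m w n u 0 0 "(a, b)"] by (simp add: fields)
qed

lemma X_cases:
  assumes "x \<in> X"
  obtains w u v where "x = (w, u, v)" "w \<in> Omega" "u \<in> Omega" "v \<in> N"
  using assms by (auto simp: X_def)

lemma closes_Phi_iff:
  assumes "x \<in> X"
  shows "closes L (Phi x) \<longleftrightarrow> closes L x"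
proof -
  obtain w u v where x: "x = (w, u, v)" "w \<in> Omega" "u \<in> Omega" using assms by (rule X_cases)
  show ?thesis
    unfolding x(1) proj_0[of w u v] Phi_proj closes_proj
    unfolding funpow_swap1[symmetric]
    using lstep_inj[OF x(2,3), of "(lstep w u ^^ L) (0, 0, v)" "(0, 0, v)"] by argo
qed

lemma Phi_in_X: "x \<in> X \<Longrightarrow> Phi x \<in> X"
  using Omega_cases[of "fst x" 0] Omega_cases[of "fst (snd x)" 0]
  by (elim X_cases) (auto simp: X_def N_def Let_def)

lemma Phi_pow_in_X: "x \<in> X \<Longrightarrow> (Phi ^^ t) x \<in> X"
  by (induction t) (simp_all add: Phi_in_X)

lemma closes_Phi_pow_iff:
  "x \<in> X \<Longrightarrow> closes L ((Phi ^^ t) x) \<longleftrightarrow> closes L x"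
  by (induction t) (simp_all add: closes_Phi_iff Phi_pow_in_X)

abbreviation CCN :: "point set" where
  "CCN \<equiv> collapsibles \<times> collapsibles \<times> N"

lemma CCN_cases:
  assumes "x \<in> CCN"
  obtains w u v where "x = (w, u, v)" "w \<in> collapsibles" "u \<in> collapsibles" "v \<in> N"
  using assms by auto

lemma CCN_subset_X: "CCN \<subseteq> X"
  by (auto simp: X_def in_collapsibles_iff)

lemma emb_0: "w \<in> collapsibles \<Longrightarrow> u \<in> collapsibles \<Longrightarrow> emb w u (0, 0, v) = (0, 0, v)"
  by (simp add: K_index_0)

lemma closes_rho_shorter:
  assumes x: "x \<in> CCN" and "closes L x"
  shows "\<exists>M<L. closes M (rho x)"
proof -
  obtain w u v where wuv: "x = (w, u, v)" "w \<in> collapsibles" "u \<in> collapsibles" "v \<in> N"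
    using x by (rule CCN_cases)
  note emb = emb_0[OF wuv(2,3), of v]
  have O: "w \<in> Omega" "u \<in> Omega" using wuv by (auto simp: in_collapsibles_iff)
  have L: "0 < L" and per: "(lstep w u ^^ L) (0, 0, v) = (0, 0, v)"
    using assms(2) wuv by auto
  have v: "snd (snd (0::int, 0::int, v)) \<in> N" using wuv by simp
  have "kept w u ((lstep w u ^^ L) (emb w u (0, 0, v)))"
    using wuv by (simp only: emb per) (simp add: in_collapsibles_iff)
  from lstep_emb_visit[OF wuv(2,3) v this] L obtain M where M: "M \<le> L" "0 < M"
    "emb w u (0, 0, v) = emb w u ((lstep (collapse w) (collapse u) ^^ M) (0, 0, v))"
    "M = L \<Longrightarrow> \<forall>s\<le>L. kept w u ((lstep w u ^^ s) (0, 0, v))"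
    unfolding emb per by metis
  have "M \<noteq> L" using M(4) no_kept_cycle[OF O L v per] by blast
  moreover have "closes M (rho x)" using emb_inj[OF wuv(2,3) M(3)] M(2) by (simp add: wuv)
  ultimately show ?thesis using M(1) by (intro exI[of _ M]) simp
qed

lemma closes_rhoD:
  assumes x: "x \<in> CCN" and "closes L (rho x)"
  shows "\<exists>M. closes M x"
proof -
  obtain w u v where wuv: "x = (w, u, v)" "w \<in> collapsibles" "u \<in> collapsibles" "v \<in> N"
    using x by (rule CCN_cases)
  have "0 < L" "(lstep (collapse w) (collapse u) ^^ L) (0, 0, v) = (0, 0, v)"
    using assms(2) wuv by auto
  with lstep_emb_pow[OF wuv(2,3), of "(0, 0, v)" L] wuv(4)
  obtain M where "M \<ge> L" "(lstep w u ^^ M) (0, 0, v) = (0, 0, v)"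
    by (auto simp: emb_0[OF wuv(2,3)] simp del: emb.simps)
  with \<open>0 < L\<close> have "closes M x" by (simp add: wuv(1))
  then show ?thesis ..
qed

text \<open>The collapsed path embeds into the kept crossings of the path of \<open>x\<close>;
  projecting such a crossing and recentring by \<open>collapse_shift\<close> gives the iterate of
  \<open>rho x\<close>.\<close>

lemma rho_Phi_pow:
  assumes x: "x \<in> CCN"
  shows "\<exists>t'. (Phi ^^ t') x \<in> CCN \<and> rho ((Phi ^^ t') x) = (Phi ^^ t) (rho x)"
proof -
  obtain w u v where wuv: "x = (w, u, v)" "w \<in> collapsibles" "u \<in> collapsibles" "v \<in> N"
    using x by (rule CCN_cases)
  let ?y = "(lstep (collapse w) (collapse u) ^^ t) (0, 0, v)"
  obtain t' where t': "(lstep w u ^^ t') (0, 0, v) = emb w u ?y"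
    using lstep_emb_pow[OF wuv(2,3), of "(0, 0, v)" t] wuv(4)
    by (auto simp: emb_0[OF wuv(2,3)] simp del: emb.simps)
  have O: "w \<in> Omega" "u \<in> Omega" using wuv by (auto simp: in_collapsibles_iff)
  have yN: "snd (snd ?y) \<in> N"
    using O wuv by (intro lstep_pow_N collapse_Omega) auto
  obtain i j v' where y: "?y = (i, j, v')" by (metis surj_pair)
  have eq: "(Phi ^^ t') x = proj w u (emb w u ?y)"
    unfolding wuv(1) proj_0[of w u v] Phi_pow_proj t' ..
  have "(Phi ^^ t') x \<in> CCN"
    unfolding eq using wuv O yN
    by (simp add: y shift_in_collapsibles_iff K_index_in_K) (simp add: in_collapsibles_iff)
  moreover have "rho ((Phi ^^ t') x) = proj (collapse w) (collapse u) ?y"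
    unfolding eq using wuv by (simp add: y collapse_shift)
  moreover have "rho x = proj (collapse w) (collapse u) (0, 0, v)"
    by (simp add: wuv)
  ultimately show ?thesis by (metis Phi_pow_proj)
qed

lemma ren_subset_X: "ren n \<subseteq> X"
  using CCN_subset_X by (cases n) auto

lemma ren_Suc_subset: "ren (Suc n) \<subseteq> ren n"
  by (induction n) (use CCN_subset_X in auto)

lemma rho_pow_in_X: "x \<in> ren n \<Longrightarrow> (rho ^^ n) x \<in> X"
  by (induction n arbitrary: x) (auto simp: funpow_swap1 simp del: rho.simps)

text \<open>\<open>ren\<close> peels off the first application of \<open>rho\<close>; here the last
  one is appended.\<close>

lemma ren_SucI: "x \<in> ren n \<Longrightarrow> (rho ^^ n) x \<in> CCN \<Longrightarrow> x \<in> ren (Suc n)"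
  by (induction n arbitrary: x)
    (auto simp: funpow_swap1 collapse_Omega in_collapsibles_iff X_def)

lemma ren_closes_gt: "x \<in> ren n \<Longrightarrow> closes L x \<Longrightarrow> n < L"
proof (induction n arbitrary: x L)
  case 0
  then show ?case by (cases x) simp
next
  case (Suc n)
  then obtain M where "M < L" "closes M (rho x)" using closes_rho_shorter[of x L] by auto
  with Suc.IH[of "rho x" M] Suc.prems show ?case by auto
qed

lemma closes_rho_powD: "x \<in> ren n \<Longrightarrow> closes L ((rho ^^ n) x) \<Longrightarrow> \<exists>M. closes M x"
proof (induction n arbitrary: x L)
  case (Suc n)
  then have "\<exists>M. closes M (rho x)" by (simp add: funpow_swap1)
  then show ?case using Suc.prems closes_rhoD[of x] by auto
qed auto

lemma rho_pow_Phi_pow: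
  "x \<in> ren n \<Longrightarrow> \<exists>t'. (Phi ^^ t') x \<in> ren n \<and> (rho ^^ n) ((Phi ^^ t') x) = (Phi ^^ t) ((rho ^^ n) x)"
proof (induction n arbitrary: x t)
  case 0
  then show ?case using Phi_pow_in_X by auto
next
  case (Suc n)
  then obtain t1 where t1: "(Phi ^^ t1) (rho x) \<in> ren n"
    "(rho ^^ n) ((Phi ^^ t1) (rho x)) = (Phi ^^ t) ((rho ^^ n) (rho x))"
    using Suc.IH[of "rho x" t] unfolding ren.simps by blast
  obtain t' where "(Phi ^^ t') x \<in> CCN" "rho ((Phi ^^ t') x) = (Phi ^^ t1) (rho x)"
    using rho_Phi_pow[of x t1] Suc.prems unfolding ren.simps by (metis (no_types, lifting) mem_Collect_eq)
  with t1 show ?case by (intro exI[of _ t']) (simp add: funpow_swap1)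
qed

subsection \<open>Stability\<close>

text \<open>Each step changes a coordinate by at most 1, so \<open>t\<close> steps from the origin
  read only signs with index at most \<open>t\<close> in absolute value.\<close>

lemma lstep_pow_local:
  assumes w: "w \<in> Omega" and u: "u \<in> Omega" and v: "v \<in> N"
    and eq: "\<And>i. \<bar>i\<bar> \<le> int t \<Longrightarrow> w' i = w i" "\<And>i. \<bar>i\<bar> \<le> int t \<Longrightarrow> u' i = u i"
  shows "(lstep w' u' ^^ t) (0, 0, v) = (lstep w u ^^ t) (0, 0, v) \<and>
    \<bar>fst ((lstep w u ^^ t) (0, 0, v))\<bar> \<le> int t \<and> \<bar>fst (snd ((lstep w u ^^ t) (0, 0, v)))\<bar> \<le> int t"
  using eq
proof (induction t)
  case (Suc t)
  obtain m n a b where z: "(lstep w u ^^ t) (0, 0, v) = (m, n, a, b)" by (metis surj_pair)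
  have IH: "(lstep w' u' ^^ t) (0, 0, v) = (m, n, a, b)" "\<bar>m\<bar> \<le> int t" "\<bar>n\<bar> \<le> int t"
    using Suc.IH Suc.prems by (auto simp: z)
  have ab: "(a, b) \<in> N" using lstep_pow_N[OF w u, of "(0, 0, v)" t] v by (simp add: z)
  have "w' m = w m" "u' n = u n" using IH Suc.prems by auto
  then show ?case
    using IH ab Omega_cases[OF w, of m] Omega_cases[OF u, of n]
    by (auto simp: z N_def)
qed simp

definition cylinder :: "nat \<Rightarrow> sequ \<Rightarrow> sequ set" where
  "cylinder M w = {w' \<in> Omega. \<forall>i. \<bar>i\<bar> \<le> int M \<longrightarrow> w' i = w i}"

lemma openin_cylinder: "openin (top_of_set Omega) (cylinder M w)"
proof -
  have "open (\<Inter>i\<in>{- int M..int M}. (\<lambda>w'::sequ. w' i) -` {w i})"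
    by (intro open_INT open_vimage continuous_on_product_coordinates open_discrete ballI) auto
  moreover have "cylinder M w = Omega \<inter> (\<Inter>i\<in>{- int M..int M}. (\<lambda>w'::sequ. w' i) -` {w i})"
    by (auto simp: cylinder_def abs_le_iff)
  ultimately show ?thesis by (auto simp: openin_open)
qed

lemma cylinder_subset_open:
  assumes "openin (top_of_set Omega) U" "w \<in> U"
  shows "\<exists>M. cylinder M w \<subseteq> U"
proof -
  obtain T where T: "open T" "U = Omega \<inter> T" using assms(1) by (auto simp: openin_open)
  have "openin (product_topology (\<lambda>i. euclidean) UNIV) T"
    using T(1) by (simp add: euclidean_product_topology)
  from product_topology_open_contains_basis[OF this, of w] assms(2) T(2)
  obtain Y where Y: "w \<in> (\<Pi>\<^sub>E i\<in>UNIV. Y i)" "finite {i. Y i \<noteq> UNIV}" "(\<Pi>\<^sub>E i\<in>UNIV. Y i) \<subseteq> T"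
    by auto
  define M where "M = nat (Max (insert 0 (abs ` {i. Y i \<noteq> UNIV})))"
  have M: "\<bar>i\<bar> \<le> int M" if "Y i \<noteq> UNIV" for i
  proof -
    have "\<bar>i\<bar> \<le> Max (insert 0 (abs ` {i. Y i \<noteq> UNIV}))" using that Y(2) by (intro Max_ge) auto
    then show ?thesis unfolding M_def by linarith
  qed
  have "cylinder M w \<subseteq> U"
  proof
    fix w' assume w': "w' \<in> cylinder M w"
    have "w' i \<in> Y i" for i
      using w' M[of i] Y(1) by (cases "Y i = UNIV") (auto simp: cylinder_def PiE_iff)
    then show "w' \<in> U" using Y(3) w' by (auto simp: T(2) cylinder_def)
  qed
  then show ?thesis ..
qed

lemma cylinder_aperiodic:
  assumes w: "w \<in> Omega" and p: "p \<noteq> 0"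
  shows "\<exists>w'\<in>cylinder M w. shift p w' \<noteq> w'"
proof -
  define c where "c = int M + 1"
  \<comment> \<open>The coordinate just outside the window is set opposite to the one \<bar>p\<bar>
    places before it, which stays unchanged as p \<noteq> 0.\<close>
  define w' where "w' = w(c := - w (c - \<bar>p\<bar>))"
  have ne: "w' (c - \<bar>p\<bar>) \<noteq> w' c" using p Omega_cases[OF w, of "c - \<bar>p\<bar>"] by (auto simp: w'_def)
  have "w' \<in> cylinder M w" using w by (auto simp: cylinder_def w'_def c_def Omega_def)
  moreover have "shift p w' \<noteq> w'"
  proof
    assume "shift p w' = w'"
    then have "w' (i + p) = w' i" for i by (metis shift_def)
    from this[of "c - p"] this[of c] show False using ne by (cases "p < 0") auto
  qed
  ultimately show ?thesis by blast
qed

lemma cylinder_mono: "M \<le> M' \<Longrightarrow> cylinder M' w \<subseteq> cylinder M w"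
  by (auto simp: cylinder_def)

lemma self_in_cylinder: "w \<in> Omega \<Longrightarrow> w \<in> cylinder M w"
  by (simp add: cylinder_def)

text \<open>All points of a small cylinder share one lifted path. If it ended at displacement
  \<open>p\<close>, every sequence in the cylinder would be fixed by \<open>shift p\<close>, so
  \<open>cylinder_aperiodic\<close> forces \<open>p = 0\<close>.\<close>

lemma stable_periodic_iff_closes:
  assumes "x \<in> X"
  shows "stable_periodic x \<longleftrightarrow> (\<exists>L. closes L x)"
proof -
  obtain w u v where x: "x = (w, u, v)" and w: "w \<in> Omega" and u: "u \<in> Omega" and v: "v \<in> N"
    using assms by (rule X_cases)
  have loc: "(Phi ^^ L) (w', u', v) = proj w' u' ((lstep w u ^^ L) (0, 0, v))"
    if "w' \<in> cylinder L w" "u' \<in> cylinder L u" for w' u' L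
    unfolding proj_0[of w' u' v] Phi_pow_proj
    using lstep_pow_local[OF w u v, of L w' u'] that by (auto simp: cylinder_def)
  show ?thesis
  proof
    assume "\<exists>L. closes L x"
    then obtain L where L: "0 < L" "(lstep w u ^^ L) (0, 0, v) = (0, 0, v)" by (auto simp: x)
    have per: "(Phi ^^ L) (w', u', v) = (w', u', v)" if "w' \<in> cylinder L w" "u' \<in> cylinder L u" for w' u'
      using loc[OF that] by (simp add: L(2))
    have "1 \<le> L" using L(1) by simp
    then show "stable_periodic x"
      unfolding x stable_periodic.simps
      by (rule exI[of _ L, OF conjI], intro exI[of _ "cylinder L w", OF exI[of _ "cylinder L u"]])
        (use per in
          \<open>simp add: openin_cylinder self_in_cylinder w u\<close>)
  next
    assume "stable_periodic x"
    then obtain L U U' where L: "L \<ge> 1" "openin (top_of_set Omega) U" "w \<in> U"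
      "openin (top_of_set Omega) U'" "u \<in> U'"
      "\<forall>w'\<in>U. \<forall>u'\<in>U'. (Phi ^^ L) (w', u', v) = (w', u', v)"
      unfolding x stable_periodic.simps by (elim exE conjE) (rule that)
    obtain M1 where M1: "cylinder M1 w \<subseteq> U" using cylinder_subset_open[OF L(2,3)] ..
    obtain M2 where M2: "cylinder M2 u \<subseteq> U'" using cylinder_subset_open[OF L(4,5)] ..
    \<comment> \<open>Large enough for the cylinders to lie in \<open>U\<close> and
      \<open>U'\<close> and for their points to share the path of length \<open>L\<close>.\<close>
    define M where "M = L + M1 + M2"
    have sub: "cylinder M w \<subseteq> U" "cylinder M u \<subseteq> U'" "cylinder M w \<subseteq> cylinder L w" "cylinder M u \<subseteq> cylinder L u"
      using M1 M2 cylinder_mono[of M1 M w] cylinder_mono[of M2 M u] cylinder_mono[of L M]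
      by (auto simp: M_def)
    obtain p q v' where z: "(lstep w u ^^ L) (0, 0, v) = (p, q, v')" by (metis surj_pair)
    have fixed: "shift p w' = w' \<and> shift q u' = u' \<and> v' = v"
      if "w' \<in> cylinder M w" "u' \<in> cylinder M u" for w' u'
    proof -
      have "(Phi ^^ L) (w', u', v) = (w', u', v)"
        by (rule L(6)[rule_format]) (rule subsetD[OF _ that(1)] subsetD[OF _ that(2)], fact sub)+
      moreover have "(Phi ^^ L) (w', u', v) = proj w' u' (p, q, v')"
        unfolding z[symmetric]
        by (rule loc) (rule subsetD[OF _ that(1)] subsetD[OF _ that(2)], fact sub)+
      ultimately show ?thesis by simp
    qed
    have "p = 0"
    proof (rule ccontr)
      assume "p \<noteq> 0"
      then obtain w' where "w' \<in> cylinder M w" "shift p w' \<noteq> w'"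
        using cylinder_aperiodic[OF w] by metis
      then show False using fixed[OF _ self_in_cylinder[OF u]] by simp
    qed
    moreover have "q = 0"
    proof (rule ccontr)
      assume "q \<noteq> 0"
      then obtain u' where "u' \<in> cylinder M u" "shift q u' \<noteq> u'"
        using cylinder_aperiodic[OF u] by metis
      then show False using fixed[OF self_in_cylinder[OF w]] by simp
    qed
    moreover have "v' = v"
      using fixed[OF self_in_cylinder[OF w] self_in_cylinder[OF u]] by simp
    ultimately have "closes L x" using L(1) z by (simp add: x)
    then show "\<exists>L. closes L x" ..
  qed
qed

section \<open>Points whose forward orbit enters the renormalization domains\<close>

definition entering :: "nat \<Rightarrow> point set" where
  "entering n = {x \<in> X. \<exists>t. (Phi ^^ t) x \<in> ren n}"

lemma entering_all_imp_NS:
  assumes "\<And>n. x \<in> entering n"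
  shows "x \<in> NS"
proof -
  have x: "x \<in> X" using assms by (auto simp: entering_def)
  have "\<not> closes L x" for L
  proof
    assume "closes L x"
    moreover obtain t where "(Phi ^^ t) x \<in> ren L" using assms by (auto simp: entering_def)
    ultimately show False using ren_closes_gt closes_Phi_pow_iff[OF x] by blast
  qed
  then show ?thesis using x by (simp add: NS_def stable_periodic_iff_closes)
qed

text \<open>A closed path of the renormalized point would pull back to one of \<open>x\<close>, so
  the dichotomy leaves a kept crossing. It is realized by a visit of \<open>x\<close> to
  \<open>ren n\<close> whose image under \<open>rho ^^ n\<close> lies in \<open>CCN\<close>.\<close>

lemma NS_entering_Suc:
  assumes NS: "x \<in> NS" and "x \<in> entering n"
    and nuc: "\<And>t. (Phi ^^ t) x \<in> ren n \<Longrightarrow> (rho ^^ n) ((Phi ^^ t) x) \<notin> NUC"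
  shows "x \<in> entering (Suc n)"
proof -
  have x: "x \<in> X" and nc: "\<not> closes L x" for L
    using NS by (auto simp: NS_def stable_periodic_iff_closes)
  obtain t where t: "(Phi ^^ t) x \<in> ren n" using assms(2) by (auto simp: entering_def)
  let ?y = "(Phi ^^ t) x"
  obtain w u v where r: "(rho ^^ n) ?y = (w, u, v)" and wuv: "w \<in> Omega" "u \<in> Omega" "v \<in> N"
    using rho_pow_in_X[OF t] by (rule X_cases)
  have unb: "unbounded_collapsible w" "unbounded_collapsible u"
    using nuc[OF t] wuv by (auto simp: r NUC_def X_def)
  have "\<not> (\<exists>L>0. (lstep w u ^^ L) (0, 0, v) = (0, 0, v))"
    using closes_rho_powD[OF t] nc closes_Phi_pow_iff[OF x] by (auto simp: r)
  then obtain s where s: "kept w u ((lstep w u ^^ s) (0, 0, v))"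
    using settles_all[OF wuv unb, of 0 0] unfolding settles_def by blast
  obtain m n' v' where z: "(lstep w u ^^ s) (0, 0, v) = (m, n', v')" by (metis surj_pair)
  have "(Phi ^^ s) ((rho ^^ n) ?y) = proj w u (m, n', v')"
    unfolding r proj_0[of w u v] Phi_pow_proj z ..
  moreover have "proj w u (m, n', v') \<in> CCN"
    using s lstep_pow_N[OF wuv(1,2), of "(0, 0, v)" s] wuv unb by (simp add: z shift_in_collapsibles_iff)
  moreover obtain t' where "(Phi ^^ t') ?y \<in> ren n" "(rho ^^ n) ((Phi ^^ t') ?y) = (Phi ^^ s) ((rho ^^ n) ?y)"
    using rho_pow_Phi_pow[OF t, of s] by blast
  ultimately have "(Phi ^^ (t' + t)) x \<in> ren (Suc n)"
    by (simp add: funpow_add ren_SucI del: ren.simps)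
  then show ?thesis using x unfolding entering_def by blast
qed

subsection \<open>Measurability\<close>

text \<open>Second countability lets Borel measurability of maps into sequences, and into products,
  be checked on coordinates.\<close>

instance int :: second_countable_topology
proof
  show "\<exists>B::int set set. countable B \<and> open = generate_topology B"
    by (intro exI[of _ "range lessThan \<union> range greaterThan"]) (auto simp: open_int_def)
qed

lemma borel_measurable_int_iff:
  fixes f :: "'a \<Rightarrow> int"
  shows "f \<in> borel_measurable M \<longleftrightarrow> f \<in> measurable M (count_space UNIV)"
  using measurable_cong_sets[OF refl sets_borel_eq_count_space] by blast

lemma measurable_sequ_coordinate:
  fixes f :: "'a \<Rightarrow> sequ"
  assumes "f \<in> borel_measurable M"
  shows "(\<lambda>x. f x i) \<in> measurable M (count_space UNIV)"
  using measurable_product_then_coordinatewise[OF assms, of i] borel_measurable_int_iff by blast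

lemma measurable_coordinate [measurable]:
  "(\<lambda>w::sequ. w i) \<in> measurable borel (count_space UNIV)"
  by (rule measurable_sequ_coordinate) simp

lemma borel_measurable_fst_snd [measurable]:
  "fst \<in> borel_measurable (borel :: ('a::topological_space \<times> 'b::topological_space) measure)"
  "snd \<in> borel_measurable (borel :: ('a::topological_space \<times> 'b::topological_space) measure)"
  by (intro borel_measurable_continuous_onI continuous_on_fst continuous_on_snd continuous_on_id)+

lemma measurable_count_space_binary:
  fixes f :: "'a \<Rightarrow> 'b::countable" and g :: "'a \<Rightarrow> 'c"
  assumes f: "f \<in> measurable M (count_space UNIV)" and g: "g \<in> measurable M (count_space UNIV)"
  shows "(\<lambda>x. h (f x) (g x)) \<in> measurable M (count_space UNIV)"
  by (rule measurable_compose_countable[OF _ f]) (rule measurable_compose[OF g], simp)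

lemma borel_measurable_shift:
  assumes f: "f \<in> borel_measurable M" and k: "k \<in> measurable M (count_space UNIV)"
  shows "(\<lambda>x. shift (k x) (f x)) \<in> borel_measurable M"
proof (rule measurable_coordinatewise_then_product)
  fix i
  have "(\<lambda>x. i + k x) \<in> measurable M (count_space UNIV)"
    by (rule measurable_compose[OF k]) simp
  then have "(\<lambda>x. f x (i + k x)) \<in> measurable M (count_space UNIV)"
    by (rule measurable_compose_countable[OF measurable_sequ_coordinate[OF f]])
  then show "(\<lambda>x. shift (k x) (f x) i) \<in> borel_measurable M"
    by (simp add: borel_measurable_int_iff shift_def)
qed

text \<open>An explicit inverse, so that measurability can be read off. The state stores the
  direction of arrival: stepping back along it finds the preceding position, and the sign read there
  undoes the reflection because \<open>s * s = 1\<close>.\<close>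

fun Phi_inv :: "point \<Rightarrow> point" where
  "Phi_inv (w, u, (a, b)) =
     (let s = w (- a) * u (- b) in (shift (- a) w, shift (- b) u, (s * b, s * a)))"

lemma point_measurable [measurable]:
  "(\<lambda>x::point. fst x) \<in> borel_measurable borel"
  "(\<lambda>x::point. fst (snd x)) \<in> borel_measurable borel"
  "(\<lambda>x::point. fst (snd (snd x))) \<in> measurable borel (count_space UNIV)"
  "(\<lambda>x::point. snd (snd (snd x))) \<in> measurable borel (count_space UNIV)"
  unfolding borel_measurable_int_iff[symmetric] by measurable

lemma Phi_measurable [measurable]: "Phi \<in> borel_measurable borel"
proof -
  define p q where "p x = (fst x 0 * fst (snd x) 0) * snd (snd (snd x))"
    and "q x = (fst x 0 * fst (snd x) 0) * fst (snd (snd x))" for x :: point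
  have s: "(\<lambda>x::point. fst x 0 * fst (snd x) 0) \<in> measurable borel (count_space UNIV)"
    by (rule measurable_count_space_binary) (rule measurable_sequ_coordinate, rule point_measurable)+
  have p: "p \<in> measurable borel (count_space UNIV)" and q: "q \<in> measurable borel (count_space UNIV)"
    unfolding p_def q_def by (rule measurable_count_space_binary[OF s], rule point_measurable)+
  note pq = p[folded borel_measurable_int_iff] q[folded borel_measurable_int_iff]
  have "(\<lambda>x. (shift (p x) (fst x), shift (q x) (fst (snd x)), p x, q x)) \<in> borel_measurable borel"
    by (rule borel_measurable_Pair borel_measurable_shift point_measurable(1,2) p q pq)+
  also have "(\<lambda>x. (shift (p x) (fst x), shift (q x) (fst (snd x)), p x, q x)) = Phi"
    by (auto simp: Let_def p_def q_def)
  finally show ?thesis .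
qed

lemma Phi_inv_measurable [measurable]: "Phi_inv \<in> borel_measurable borel"
proof -
  define a b where "a x = - fst (snd (snd x))" and "b x = - snd (snd (snd x))" for x :: point
  define p q where "p x = (fst x (a x) * fst (snd x) (b x)) * snd (snd (snd x))"
    and "q x = (fst x (a x) * fst (snd x) (b x)) * fst (snd (snd x))" for x :: point
  have a: "a \<in> measurable borel (count_space UNIV)" and b: "b \<in> measurable borel (count_space UNIV)"
    unfolding a_def b_def
    by (rule measurable_compose[OF point_measurable(3)], simp)
      (rule measurable_compose[OF point_measurable(4)], simp)
  have s: "(\<lambda>x. fst x (a x) * fst (snd x) (b x)) \<in> measurable borel (count_space UNIV)"
    by (rule measurable_count_space_binary)
      (rule measurable_compose_countable[OF _ a] measurable_compose_countable[OF _ b],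
        rule measurable_sequ_coordinate, rule point_measurable)+
  have p: "p \<in> measurable borel (count_space UNIV)" and q: "q \<in> measurable borel (count_space UNIV)"
    unfolding p_def q_def by (rule measurable_count_space_binary[OF s], rule point_measurable)+
  note pq = p[folded borel_measurable_int_iff] q[folded borel_measurable_int_iff]
  have "(\<lambda>x. (shift (a x) (fst x), shift (b x) (fst (snd x)), p x, q x)) \<in> borel_measurable borel"
    by (rule borel_measurable_Pair borel_measurable_shift point_measurable(1,2) a b pq)+
  also have "(\<lambda>x. (shift (a x) (fst x), shift (b x) (fst (snd x)), p x, q x)) = Phi_inv"
    by (auto simp: Let_def a_def b_def p_def q_def)
  finally show ?thesis .
qed

lemma pred_Omega [measurable]: "Measurable.pred borel (\<lambda>w. w \<in> Omega)"
  unfolding Omega_def mem_Collect_eq insert_iff empty_iff by measurable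

lemma pred_K [measurable]: "Measurable.pred borel (\<lambda>w. k \<in> K w)"
  unfolding K_def S_def mem_Collect_eq Un_iff shift_Omega unfolding shift_def by measurable

lemma pred_unbounded_collapsible [measurable]: "Measurable.pred borel unbounded_collapsible"
proof -
  have "Measurable.pred borel (\<lambda>w. (\<forall>n. \<exists>k. k \<in> K w \<and> n < k) \<and> (\<forall>n. \<exists>k. k \<in> K w \<and> k < n))"
    by measurable
  then show ?thesis by (simp add: unbounded_collapsible_iff Bex_def cong: measurable_cong)
qed

lemma pred_collapsibles [measurable]: "Measurable.pred borel (\<lambda>w. w \<in> collapsibles)"
  unfolding in_collapsibles_iff by measurable

text \<open>Expresses the next index through \<open>K\<close> and the current index, without the
  \<open>THE\<close> of \<open>K_index\<close>; this drives the induction in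
  \<open>pred_K_index\<close>.\<close>

lemma K_index_Suc_iff:
  assumes "w \<in> collapsibles"
  shows "K_index w (i + 1) = k \<longleftrightarrow>
    k \<in> K w \<and> K_index w i < k \<and> (\<forall>l. K_index w i < l \<longrightarrow> l < k \<longrightarrow> l \<notin> K w)"
proof -
  note less = strict_mono_less[OF strict_mono_K_index[OF assms]]
  have gap: "l \<notin> K w" if "K_index w i < l" "l < K_index w (i + 1)" for l
    using that less unfolding range_K_index[OF assms, symmetric] by force
  show ?thesis
    using gap less[of i "i + 1"] K_index_in_K[OF assms, of "i + 1"]
    by (metis less_add_one linorder_neqE)
qed

lemma K_index_pred_iff:
  assumes "w \<in> collapsibles"
  shows "K_index w (i - 1) = k \<longleftrightarrow>
    k \<in> K w \<and> k < K_index w i \<and> (\<forall>l. k < l \<longrightarrow> l < K_index w i \<longrightarrow> l \<notin> K w)"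
proof -
  note less = strict_mono_less[OF strict_mono_K_index[OF assms]]
  have gap: "l \<notin> K w" if "l < K_index w i" "K_index w (i - 1) < l" for l
    using that less unfolding range_K_index[OF assms, symmetric] by force
  have "K_index w (i - 1) < K_index w i" by (simp add: less)
  then show ?thesis
    using gap K_index_in_K[OF assms, of "i - 1"] by (metis linorder_neqE)
qed

text \<open>The value at the neighbouring index is quantified over the countable type
  \<open>int\<close>. Membership in \<open>collapsibles\<close> is part of the predicate because the
  recursion for \<open>K_index\<close> is available only there.\<close>

lemma pred_K_index [measurable]: "Measurable.pred borel (\<lambda>w. w \<in> collapsibles \<and> K_index w i = k)"
proof (induction i arbitrary: k rule: int_induct[where k = 0])
  case base
  have "Measurable.pred borel (\<lambda>w. w \<in> collapsibles \<and> 0 = k)" by measurable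
  then show ?case by (rule measurable_cong[THEN iffD1, rotated]) (auto simp: K_index_0)
next
  case (step1 i)
  note step1(2)[measurable]
  have "Measurable.pred borel (\<lambda>w. \<exists>j. (w \<in> collapsibles \<and> K_index w i = j) \<and>
      k \<in> K w \<and> j < k \<and> (\<forall>l. j < l \<longrightarrow> l < k \<longrightarrow> l \<notin> K w))"
    by measurable
  then show ?case by (rule measurable_cong[THEN iffD1, rotated]) (use K_index_Suc_iff in blast)
next
  case (step2 i)
  note step2(2)[measurable]
  have "Measurable.pred borel (\<lambda>w. \<exists>j. (w \<in> collapsibles \<and> K_index w i = j) \<and>
      k \<in> K w \<and> k < j \<and> (\<forall>l. k < l \<longrightarrow> l < j \<longrightarrow> l \<notin> K w))"
    by measurable
  then show ?case by (rule measurable_cong[THEN iffD1, rotated]) (use K_index_pred_iff in blast)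
qed

lemma collapse_measurable:
  assumes f: "f \<in> borel_measurable M" and sub: "\<And>x. x \<in> space M \<Longrightarrow> f x \<in> collapsibles"
  shows "(\<lambda>x. collapse (f x)) \<in> borel_measurable M"
proof (rule measurable_coordinatewise_then_product)
  fix i
  have "(\<lambda>x. K_index (f x) i) \<in> measurable M (count_space UNIV)"
  proof (subst measurable_count_space_eq2_countable, safe)
    fix k
    have "Measurable.pred M (\<lambda>x. f x \<in> collapsibles \<and> K_index (f x) i = k)"
      by (rule measurable_compose[OF f]) (rule pred_K_index)
    then have "{x \<in> space M. f x \<in> collapsibles \<and> K_index (f x) i = k} \<in> sets M" by simp
    also have "{x \<in> space M. f x \<in> collapsibles \<and> K_index (f x) i = k} =
        (\<lambda>x. K_index (f x) i) -` {k} \<inter> space M" using sub by auto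
    finally show "(\<lambda>x. K_index (f x) i) -` {k} \<inter> space M \<in> sets M" .
  qed auto
  from measurable_compose_countable[OF measurable_sequ_coordinate[OF f] this]
  show "(\<lambda>x. collapse (f x) i) \<in> borel_measurable M"
    by (simp add: borel_measurable_int_iff collapse_def)
qed

lemma N_finite: "finite N"
  by (simp add: N_def)

lemma borel_N [measurable]: "N \<in> sets borel"
  using N_finite by (auto intro: finite_imp_closed borel_closed)

lemma borel_X [measurable]: "X \<in> sets borel"
proof -
  have "{x \<in> space borel. fst x \<in> Omega \<and> fst (snd x) \<in> Omega \<and> snd (snd x) \<in> N} \<in> sets borel"
    by measurable
  also have "{x \<in> space borel. fst x \<in> Omega \<and> fst (snd x) \<in> Omega \<and> snd (snd x) \<in> N} = X"
    by (auto simp: X_def)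
  finally show ?thesis .
qed

lemma borel_CCN [measurable]: "CCN \<in> sets borel"
proof -
  have "{x \<in> space borel. fst x \<in> collapsibles \<and> fst (snd x) \<in> collapsibles \<and> snd (snd x) \<in> N} \<in> sets borel"
    by measurable
  also have "{x \<in> space borel. fst x \<in> collapsibles \<and> fst (snd x) \<in> collapsibles \<and> snd (snd x) \<in> N} = CCN"
    by auto
  finally show ?thesis .
qed

lemma borel_NUC [measurable]: "NUC \<in> sets borel"
proof -
  have "{x \<in> space borel. x \<in> X \<and> (\<not> unbounded_collapsible (fst x) \<or>
      \<not> unbounded_collapsible (fst (snd x)))} \<in> sets borel"
    by measurable
  also have "{x \<in> space borel. x \<in> X \<and> (\<not> unbounded_collapsible (fst x) \<or>
      \<not> unbounded_collapsible (fst (snd x)))} = NUC"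
    by (auto simp: NUC_def)
  finally show ?thesis .
qed

lemma rho_measurable: "rho \<in> measurable (restrict_space borel CCN) borel"
proof -
  have m: "(\<lambda>x. g x) \<in> borel_measurable (restrict_space borel CCN)"
    if "g \<in> borel_measurable borel" for g :: "point \<Rightarrow> 'c::topological_space"
    using that by (rule measurable_restrict_space1)
  have "(\<lambda>x::point. (collapse (fst x), collapse (fst (snd x)), snd (snd x)))
      \<in> borel_measurable (restrict_space borel CCN)"
    by (intro borel_measurable_Pair collapse_measurable m point_measurable)
      (auto simp: space_restrict_space, measurable)
  also have "(\<lambda>x::point. (collapse (fst x), collapse (fst (snd x)), snd (snd x))) = rho" by auto
  finally show ?thesis .
qed

lemma rho_pow_vimage_borel: "B \<in> sets borel \<Longrightarrow> {x \<in> ren n. (rho ^^ n) x \<in> B} \<in> sets borel"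
proof (induction n)
  case 0
  then have "X \<inter> B \<in> sets borel" by measurable
  then show ?case by (simp add: Int_def)
next
  case (Suc n)
  have "rho -` {x \<in> ren n. (rho ^^ n) x \<in> B} \<inter> space (restrict_space borel CCN)
      \<in> sets (restrict_space borel CCN)"
    by (rule measurable_sets[OF rho_measurable Suc.IH[OF Suc.prems]])
  then have "rho -` {x \<in> ren n. (rho ^^ n) x \<in> B} \<inter> CCN \<in> sets borel"
    by (simp add: sets_restrict_space_iff space_restrict_space)
  also have "rho -` {x \<in> ren n. (rho ^^ n) x \<in> B} \<inter> CCN = {x \<in> ren (Suc n). (rho ^^ Suc n) x \<in> B}"
    by (auto simp: funpow_swap1 simp del: rho.simps)
  finally show ?case .
qed

lemma borel_ren [measurable]: "ren n \<in> sets borel"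
  using rho_pow_vimage_borel[of UNIV n] by simp

lemma sets_borelX: "A \<in> sets borelX \<longleftrightarrow> A \<subseteq> X \<and> A \<in> sets borel"
  by (simp add: borelX_def sets_restrict_space_iff)

lemma space_borelX: "space borelX = X"
  by (simp add: borelX_def space_restrict_space)

lemma rho_pow_measurable: "rho ^^ n \<in> measurable (restrict_space borelX (ren n)) borelX"
proof (rule measurableI)
  fix x assume "x \<in> space (restrict_space borelX (ren n))"
  then show "(rho ^^ n) x \<in> space borelX"
    by (simp add: space_borelX space_restrict_space rho_pow_in_X)
next
  fix B assume "B \<in> sets borelX"
  then have "{x \<in> ren n. (rho ^^ n) x \<in> B} \<in> sets borel"
    by (intro rho_pow_vimage_borel) (simp add: sets_borelX)
  moreover have "(rho ^^ n) -` B \<inter> space (restrict_space borelX (ren n)) = {x \<in> ren n. (rho ^^ n) x \<in> B}"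
    using ren_subset_X by (auto simp: space_borelX space_restrict_space)
  moreover have "ren n \<inter> space borelX \<in> sets borelX"
    by (simp add: space_borelX sets_borelX)
  ultimately show "(rho ^^ n) -` B \<inter> space (restrict_space borelX (ren n)) \<in> sets (restrict_space borelX (ren n))"
    using ren_subset_X[of n] by (auto simp: sets_restrict_space_iff sets_borelX)
qed

section \<open>The inverse of \<open>Phi\<close> and two-sided orbits\<close>

lemma Omega_product_square: "w \<in> Omega \<Longrightarrow> u \<in> Omega \<Longrightarrow> w i * u j * (w i * u j * a) = a"
  using Omega_cases[of w i] Omega_cases[of u j] by auto

lemma Phi_inv_in_X: "x \<in> X \<Longrightarrow> Phi_inv x \<in> X"
proof (elim X_cases)
  fix w u v assume x: "x = (w, u, v)" "w \<in> Omega" "u \<in> Omega" "v \<in> N"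
  obtain a b where "v = (a, b)" by (cases v)
  then show ?thesis
    using x Omega_cases[OF x(2), of "- a"] Omega_cases[OF x(3), of "- b"]
    by (auto simp: X_def N_def Let_def)
qed

lemma Phi_Phi_inv: "x \<in> X \<Longrightarrow> Phi (Phi_inv x) = x"
  by (elim X_cases) (auto simp: Let_def Omega_product_square shift_def)

lemma Phi_inv_Phi: "x \<in> X \<Longrightarrow> Phi_inv (Phi x) = x"
  by (elim X_cases) (auto simp: Let_def Omega_product_square shift_def)

lemma inv_into_Phi: "x \<in> X \<Longrightarrow> inv_into X Phi x = Phi_inv x"
proof (rule inv_into_f_eq)
  show "inj_on Phi X" by (rule inj_on_inverseI[where g = Phi_inv]) (rule Phi_inv_Phi)
qed (simp_all add: Phi_inv_in_X Phi_Phi_inv)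

lemma Phi_inv_pow_in_X: "x \<in> X \<Longrightarrow> (Phi_inv ^^ k) x \<in> X"
  by (induction k) (simp_all add: Phi_inv_in_X)

lemma inv_into_Phi_pow: "x \<in> X \<Longrightarrow> (inv_into X Phi ^^ k) x = (Phi_inv ^^ k) x"
  by (induction k) (simp_all add: inv_into_Phi Phi_inv_pow_in_X)

lemma Phi_pow_Phi_inv_pow: "x \<in> X \<Longrightarrow> (Phi ^^ k) ((Phi_inv ^^ k) x) = x"
  by (induction k) (simp_all add: funpow_swap1[of Phi] Phi_Phi_inv Phi_inv_pow_in_X)

lemma Phi_inv_pow_Phi_pow: "x \<in> X \<Longrightarrow> (Phi_inv ^^ k) ((Phi ^^ k) x) = x"
  by (induction k) (simp_all add: funpow_swap1[of Phi_inv] Phi_inv_Phi Phi_pow_in_X)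

text \<open>Every orbit point in \<open>ren n\<close> is reached by going back \<open>k\<close>
  steps and then forward: \<open>k = 0\<close> serves negative exponents, \<open>k = m\<close> the
  others. The sets increase with \<open>k\<close>, which \<open>emeasure_orb\<close>
  exploits.\<close>

lemma orb_eq: "orb n = (\<Union>k. {x \<in> X. (Phi_inv ^^ k) x \<in> entering n})"
proof (intro equalityI subsetI)
  fix x assume "x \<in> orb n"
  then obtain m y where y: "y \<in> ren n" "x = Phi_pow m y" by (auto simp: orb_def)
  have yX: "y \<in> X" using y(1) ren_subset_X by blast
  show "x \<in> (\<Union>k. {x \<in> X. (Phi_inv ^^ k) x \<in> entering n})"
  proof (cases "0 \<le> m")
    case True
    then have x: "x = (Phi ^^ nat m) y" by (simp add: y Phi_pow_def)
    have "y \<in> entering n" using y(1) yX unfolding entering_def by (auto intro!: exI[of _ 0])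
    then have "(Phi_inv ^^ nat m) x \<in> entering n" using Phi_inv_pow_Phi_pow[OF yX] by (simp add: x)
    moreover have "x \<in> X" unfolding x by (rule Phi_pow_in_X[OF yX])
    ultimately show ?thesis by blast
  next
    case False
    then have x: "x = (Phi_inv ^^ nat (- m)) y" by (simp add: y Phi_pow_def inv_into_Phi_pow yX)
    have xX: "x \<in> X" unfolding x by (rule Phi_inv_pow_in_X[OF yX])
    moreover have "(Phi ^^ nat (- m)) x \<in> ren n" unfolding x Phi_pow_Phi_inv_pow[OF yX] by (rule y)
    ultimately have "(Phi_inv ^^ 0) x \<in> entering n" by (auto simp: entering_def)
    with xX show ?thesis by blast
  qed
next
  fix x assume "x \<in> (\<Union>k. {x \<in> X. (Phi_inv ^^ k) x \<in> entering n})"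
  then obtain k t where x: "x \<in> X" "(Phi ^^ t) ((Phi_inv ^^ k) x) \<in> ren n" by (auto simp: entering_def)
  let ?z = "(Phi_inv ^^ k) x" and ?y = "(Phi ^^ t) ((Phi_inv ^^ k) x)"
  have zX: "?z \<in> X" by (rule Phi_inv_pow_in_X[OF x(1)])
  have yX: "?y \<in> X" by (rule Phi_pow_in_X[OF zX])
  have xz: "x = (Phi ^^ k) ?z" by (simp add: Phi_pow_Phi_inv_pow x(1))
  show "x \<in> orb n"
  proof (cases "t \<le> k")
    case True
    have "x = (Phi ^^ (k - t)) ?y" using xz True by (simp flip: funpow_add[unfolded comp_def, THEN fun_cong])
    then have "x = Phi_pow (int (k - t)) ?y" by (simp add: Phi_pow_def)
    then show ?thesis using x(2) unfolding orb_def by blast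
  next
    case False
    have "?y = (Phi ^^ (t - k)) x"
    proof -
      have "?y = (Phi ^^ ((t - k) + k)) ?z" using False by simp
      also have "\<dots> = (Phi ^^ (t - k)) x" unfolding funpow_add comp_apply xz[symmetric] ..
      finally show ?thesis .
    qed
    then have "x = (Phi_inv ^^ (t - k)) ?y" by (simp add: Phi_inv_pow_Phi_pow x(1))
    then have "x = Phi_pow (- int (t - k)) ?y"
      using False yX unfolding Phi_pow_def by (simp add: inv_into_Phi_pow nat_diff_distrib)
    then show ?thesis using x(2) unfolding orb_def by blast
  qed
qed

subsection \<open>First return times\<close>

lemma measurable_funpow:
  assumes "T \<in> measurable M M"
  shows "T ^^ k \<in> measurable M M"
proof (induction k)
  case 0
  then show ?case by (simp add: id_def)
next
  case (Suc k)
  show ?case unfolding funpow.simps by (rule measurable_comp[OF Suc assms])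
qed

text \<open>\<open>W k\<close> is first entrance into \<open>A\<close> at time \<open>k\<close>,
  \<open>Q k\<close> the part of \<open>A\<close> without return up to time \<open>k\<close>,
  \<open>R k\<close> the part with first return at \<open>k + 1\<close>. Both \<open>W\<close> and
  \<open>Q\<close> start from \<open>A\<close> and lose the measure of \<open>R k\<close> in passing
  to \<open>Suc k\<close>, so their measures agree. The return time is the sum of the indicators of
  the \<open>Q k\<close>, while the \<open>W k\<close> partition the points that ever enter
  \<open>A\<close>.\<close>

lemma (in finite_measure) nn_integral_first_return_eq:
  assumes T: "T \<in> measurable M M"
    and inv: "\<And>B. B \<in> sets M \<Longrightarrow> emeasure M (T -` B \<inter> space M) = emeasure M B"
    and A: "A \<in> sets M"
  shows "(\<integral>\<^sup>+x\<in>A. of_nat (LEAST m. 0 < m \<and> (T ^^ m) x \<in> A) \<partial>M) =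
    emeasure M {x \<in> space M. \<exists>k. (T ^^ k) x \<in> A}"
proof -
  note [measurable] = T A
  have Tk [measurable]: "T ^^ k \<in> measurable M M" for k by (rule measurable_funpow[OF T])
  define W where "W k = {x \<in> space M. (T ^^ k) x \<in> A \<and> (\<forall>j<k. (T ^^ j) x \<notin> A)}" for k
  define Q where "Q k = {x \<in> space M. x \<in> A \<and> (\<forall>j\<in>{0<..k}. (T ^^ j) x \<notin> A)}" for k
  define R where "R k = {x \<in> space M. x \<in> A \<and> (T ^^ Suc k) x \<in> A \<and> (\<forall>j\<in>{0<..k}. (T ^^ j) x \<notin> A)}" for k
  have sets [measurable]: "W k \<in> sets M" "Q k \<in> sets M" "R k \<in> sets M" for k
    unfolding W_def Q_def R_def by measurable
  \<comment> \<open>First entrance at time \<open>k\<close> and no return up to time \<open>k\<close> obey the same recursion.\<close>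
  have W_eq: "emeasure M (W k) = emeasure M (R k) + emeasure M (W (Suc k))" for k
  proof -
    have shift: "(\<forall>j<k. (T ^^ j) (T x) \<notin> A) \<longleftrightarrow> (\<forall>j\<in>{0<..k}. (T ^^ j) x \<notin> A)" for x
    proof
      assume a: "\<forall>j<k. (T ^^ j) (T x) \<notin> A"
      show "\<forall>j\<in>{0<..k}. (T ^^ j) x \<notin> A"
      proof
        fix j assume "j \<in> {0<..k}"
        then obtain i where "j = Suc i" "i < k" by (cases j) auto
        with a show "(T ^^ j) x \<notin> A" by (simp add: funpow_swap1)
      qed
    next
      assume a: "\<forall>j\<in>{0<..k}. (T ^^ j) x \<notin> A"
      show "\<forall>j<k. (T ^^ j) (T x) \<notin> A"
      proof (intro allI impI)
        fix j assume "j < k"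
        then show "(T ^^ j) (T x) \<notin> A" using a[rule_format, of "Suc j"] by (simp add: funpow_swap1)
      qed
    qed
    have less_Suc: "(\<forall>j<Suc k. (T ^^ j) x \<notin> A) \<longleftrightarrow> x \<notin> A \<and> (\<forall>j\<in>{0<..k}. (T ^^ j) x \<notin> A)" for x
    proof -
      have eq: "{..<Suc k} = insert 0 {0<..k}" by auto
      have "(\<forall>j<Suc k. (T ^^ j) x \<notin> A) \<longleftrightarrow> (\<forall>j\<in>{..<Suc k}. (T ^^ j) x \<notin> A)" by blast
      then show ?thesis unfolding eq by simp
    qed
    \<comment> \<open>If T x first enters at time k, then time k + 1 is the first return of x when x
      lies in A, and its first entrance otherwise.\<close>
    have "T -` W k \<inter> space M = R k \<union> W (Suc k)"
      unfolding W_def R_def less_Suc using measurable_space[OF T] by (auto simp: shift funpow_swap1)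
    moreover have "R k \<inter> W (Suc k) = {}"
      unfolding W_def R_def less_Suc by auto
    ultimately show ?thesis using inv[OF sets(1)[of k]] plus_emeasure[OF sets(3) sets(1)] by metis
  qed
  have Q_eq: "emeasure M (Q k) = emeasure M (R k) + emeasure M (Q (Suc k))" for k
  proof -
    have "{0<..Suc k} = insert (Suc k) {0<..k}" by auto
    then have "Q k = R k \<union> Q (Suc k)" "R k \<inter> Q (Suc k) = {}"
      unfolding Q_def R_def by auto
    then show ?thesis using plus_emeasure[OF sets(3) sets(2)] by metis
  qed
  have QW: "emeasure M (Q k) = emeasure M (W k)" for k
  proof (induction k)
    case 0
    then show ?case by (simp add: Q_def W_def)
  next
    case (Suc k)
    \<comment> \<open>Finiteness of the measure of \<open>R k\<close> permits cancelling it.\<close>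
    then show ?case using Q_eq[of k] W_eq[of k] emeasure_finite[of "R k"]
      by (simp add: ennreal_add_left_cancel)
  qed
  have W_disj: "disjoint_family W"
    unfolding disjoint_family_on_def
  proof (intro ballI impI)
    fix i j :: nat assume "i \<noteq> j"
    then show "W i \<inter> W j = {}" unfolding W_def by (cases i j rule: linorder_cases) auto
  qed
  have W_UN: "(\<Union>k. W k) = {x \<in> space M. \<exists>k. (T ^^ k) x \<in> A}"
  proof (intro equalityI subsetI)
    fix x assume "x \<in> {x \<in> space M. \<exists>k. (T ^^ k) x \<in> A}"
    then have "x \<in> space M" "\<exists>k. (T ^^ k) x \<in> A" by auto
    then have "x \<in> W (LEAST k. (T ^^ k) x \<in> A)"
      unfolding W_def using LeastI_ex[of "\<lambda>k. (T ^^ k) x \<in> A"] not_less_Least by blast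
    then show "x \<in> (\<Union>k. W k)" by blast
  qed (auto simp: W_def)
  let ?F = "\<lambda>x. \<Sum>k. indicator (Q k) x :: ennreal"
  have int_F: "integral\<^sup>N M ?F = emeasure M {x \<in> space M. \<exists>k. (T ^^ k) x \<in> A}"
  proof -
    have "integral\<^sup>N M ?F = (\<Sum>k. emeasure M (W k))"
      by (subst nn_integral_suminf) (simp_all add: QW)
    also have "\<dots> = emeasure M (\<Union>k. W k)"
      by (rule suminf_emeasure[OF _ W_disj]) auto
    finally show ?thesis unfolding W_UN .
  qed
  \<comment> \<open>Points of \<open>A\<close> that never return lie in every \<open>Q k\<close>, so
    \<open>?F\<close> is infinite there. The finite integral makes them null, and the unspecified
    \<open>LEAST\<close> does no harm.\<close>
  have fin: "AE x in M. ?F x \<noteq> \<infinity>"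
    by (rule nn_integral_PInf_AE) (simp_all add: int_F)
  have "(\<integral>\<^sup>+x\<in>A. of_nat (LEAST m. 0 < m \<and> (T ^^ m) x \<in> A) \<partial>M) = integral\<^sup>N M ?F"
  proof (rule nn_integral_cong_AE)
    show "AE x in M. of_nat (LEAST m. 0 < m \<and> (T ^^ m) x \<in> A) * indicator A x = ?F x"
      using fin AE_space
    proof eventually_elim
      case (elim x)
      show ?case
      proof (cases "x \<in> A")
        case False
        then show ?thesis by (simp add: Q_def)
      next
        case True
        show ?thesis
        proof (cases "\<exists>m. 0 < m \<and> (T ^^ m) x \<in> A")
          case ret: True
          define r where "r = (LEAST m. 0 < m \<and> (T ^^ m) x \<in> A)"
          have r: "0 < r" "(T ^^ r) x \<in> A" using LeastI_ex[OF ret] by (auto simp: r_def)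
          have before: "(T ^^ j) x \<notin> A" if "0 < j" "j < r" for j
            using not_less_Least[of j "\<lambda>m. 0 < m \<and> (T ^^ m) x \<in> A"] that by (auto simp: r_def)
          have Q_iff: "x \<in> Q k \<longleftrightarrow> k < r" for k
          proof
            assume "x \<in> Q k"
            then have "r \<notin> {0<..k}" using r(2) by (auto simp: Q_def)
            then show "k < r" using r(1) by auto
          next
            assume "k < r"
            then show "x \<in> Q k" using True elim(2) before by (simp add: Q_def)
          qed
          have "?F x = (\<Sum>k<r. indicator (Q k) x)" by (rule suminf_finite) (auto simp: Q_iff)
          also have "\<dots> = of_nat r" by (simp add: Q_iff)
          finally show ?thesis using True by (simp add: r_def)
        next
          case False
          then have "x \<in> Q k" for k
            using True elim(2) unfolding Q_def mem_Collect_eq Ball_def greaterThanAtMost_iff by blast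
          then have F: "?F x = (\<Sum>k::nat. 1)" by simp
          have "of_nat m \<le> ?F x" for m
            using sum_le_suminf[of "\<lambda>_. 1 :: ennreal" "{..<m}"] unfolding F by simp
          then have "?F x = \<infinity>"
            using ennreal_Ex_less_of_nat[of "?F x"] by (metis infinity_ennreal_def less_top not_le)
          then show ?thesis using elim(1) by simp
        qed
      qed
    qed
  qed
  with int_F show ?thesis by simp
qed

section \<open>Finite invariant measures: return times, conditional expectation, limit\<close>

context
  fixes \<nu> :: "point measure"
  assumes fin: "finite_measure \<nu>" and sets_nu: "sets \<nu> = sets borelX"
    and inv: "Phi_invariant \<nu>"
begin

interpretation finite_measure \<nu> by (rule fin)

lemma space_nu: "space \<nu> = X"
  using sets_eq_imp_space_eq[OF sets_nu] by (simp add: space_borelX)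

lemma in_sets_nu: "A \<in> sets \<nu> \<longleftrightarrow> A \<subseteq> X \<and> A \<in> sets borel"
  by (simp add: sets_nu sets_borelX)

lemma ren_sets_nu: "ren n \<in> sets \<nu>"
  by (simp add: in_sets_nu ren_subset_X)

lemma measurable_nu_self:
  assumes "g \<in> borel_measurable borel" "\<And>x. x \<in> X \<Longrightarrow> g x \<in> X"
  shows "g \<in> measurable \<nu> \<nu>"
proof (rule measurableI)
  fix B assume "B \<in> sets \<nu>"
  then have "g -` B \<in> sets borel" using measurable_sets_borel[OF assms(1)] by (simp add: in_sets_nu)
  then show "g -` B \<inter> space \<nu> \<in> sets \<nu>" by (auto simp: in_sets_nu space_nu)
qed (simp add: space_nu assms)

lemmas Phi_measurable_nu = measurable_nu_self[OF Phi_measurable Phi_in_X]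
  and Phi_inv_measurable_nu = measurable_nu_self[OF Phi_inv_measurable Phi_inv_in_X]

lemma emeasure_Phi_vimage: "B \<in> sets \<nu> \<Longrightarrow> emeasure \<nu> (Phi -` B \<inter> space \<nu>) = emeasure \<nu> B"
  using inv unfolding Phi_invariant_def sets_nu
  by (simp add: space_nu vimage_def Int_def conj_commute)

lemma entering_sets_nu: "entering n \<in> sets \<nu>"
proof -
  note [measurable] = measurable_funpow[OF Phi_measurable_nu] ren_sets_nu
  have "{x \<in> space \<nu>. \<exists>t. (Phi ^^ t) x \<in> ren n} \<in> sets \<nu>" by measurable
  then show ?thesis by (simp add: entering_def space_nu)
qed

lemma emeasure_Phi_pow_vimage:
  "B \<in> sets \<nu> \<Longrightarrow> emeasure \<nu> ((Phi ^^ t) -` B \<inter> space \<nu>) = emeasure \<nu> B"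
proof (induction t arbitrary: B)
  case 0
  then show ?case using sets.sets_into_space by (simp add: Int_absorb2)
next
  case (Suc t)
  have "(Phi ^^ Suc t) -` B \<inter> space \<nu> = (Phi ^^ t) -` (Phi -` B \<inter> space \<nu>) \<inter> space \<nu>"
    using Phi_pow_in_X by (auto simp: space_nu)
  then show ?case
    using Suc.IH[OF measurable_sets[OF Phi_measurable_nu Suc.prems]] emeasure_Phi_vimage[OF Suc.prems]
    by metis
qed

text \<open>The sets \<open>V k\<close> increase, since from one step further back the forward orbit
  still meets \<open>ren n\<close>. By invariance all have the measure of \<open>entering n\<close>,
  hence so does their union.\<close>

lemma emeasure_orb: "emeasure \<nu> (orb n) = emeasure \<nu> (entering n)"
proof -
  define V where "V k = (Phi_inv ^^ k) -` entering n \<inter> space \<nu>" for k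
  have V_sets: "V k \<in> sets \<nu>" for k
    unfolding V_def by (rule measurable_sets[OF measurable_funpow[OF Phi_inv_measurable_nu] entering_sets_nu])
  have orb: "orb n = (\<Union>k. V k)" by (auto simp: orb_eq V_def space_nu)
  have "incseq V"
  proof (rule incseq_SucI, rule subsetI)
    fix k x assume x: "x \<in> V k"
    define y where "y = (Phi_inv ^^ k) x"
    have xX: "x \<in> X" and "y \<in> entering n" using x by (auto simp: V_def space_nu y_def)
    then obtain t where y: "y \<in> X" "(Phi ^^ t) y \<in> ren n" by (auto simp: entering_def)
    have "(Phi ^^ Suc t) (Phi_inv y) \<in> ren n"
      using y by (simp add: funpow_swap1 Phi_Phi_inv)
    then have "Phi_inv y \<in> entering n" using Phi_inv_in_X[OF y(1)] unfolding entering_def by blast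
    then show "x \<in> V (Suc k)" using xX by (simp add: V_def space_nu y_def)
  qed
  moreover have "emeasure \<nu> (V k) = emeasure \<nu> (entering n)" for k
  proof (induction k)
    case 0
    then show ?case using sets.sets_into_space[OF entering_sets_nu] by (simp add: V_def Int_absorb2)
  next
    case (Suc k)
    have "Phi -` V (Suc k) \<inter> space \<nu> = V k"
    proof (intro equalityI subsetI)
      fix x assume "x \<in> Phi -` V (Suc k) \<inter> space \<nu>"
      then show "x \<in> V k"
        using Phi_inv_Phi[of x] by (simp add: V_def space_nu funpow_swap1 del: Phi.simps Phi_inv.simps)
    next
      fix x assume "x \<in> V k"
      then show "x \<in> Phi -` V (Suc k) \<inter> space \<nu>"
        using Phi_inv_Phi[of x] Phi_in_X[of x]
        by (simp add: V_def space_nu funpow_swap1 del: Phi.simps Phi_inv.simps)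
    qed
    then show ?case using emeasure_Phi_vimage[OF V_sets[of "Suc k"]] Suc by simp
  qed
  ultimately show ?thesis
    using SUP_emeasure_incseq[of V \<nu>] V_sets by (simp add: orb image_subset_iff)
qed

lemma nn_integral_return_time:
  "(\<integral>\<^sup>+x\<in>ren n. ennreal (real (return_time n x)) \<partial>\<nu>) = emeasure \<nu> (orb n)"
  using nn_integral_first_return_eq[OF Phi_measurable_nu emeasure_Phi_vimage ren_sets_nu[of n]]
  by (simp add: return_time_def ennreal_of_nat_eq_real_of_nat emeasure_orb entering_def space_nu)

lemma return_time_measurable: "(\<lambda>x. real (return_time n x)) \<in> borel_measurable \<nu>"
proof -
  note [measurable] = measurable_funpow[OF Phi_measurable_nu] ren_sets_nu
  have "return_time n \<in> measurable \<nu> (count_space UNIV)"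
    unfolding return_time_def by measurable
  then show ?thesis by measurable
qed

text \<open>The \<open>SOME\<close> in \<open>return_cond_exp\<close> has content only once a
  version exists. It is the derivative, with respect to \<open>push \<nu> n\<close>, of the image
  under \<open>rho ^^ n\<close> of the measure whose density is the return time.\<close>

lemma return_cond_exp_exists: "\<exists>g. is_return_cond_exp \<nu> n (\<lambda>_. 1) g"
proof -
  define r where "r x = real (return_time n x)" for x
  have sum_r: "return_sum n (\<lambda>_. 1) = r" by (simp add: fun_eq_iff return_sum_def r_def)
  have r_meas [measurable]: "r \<in> borel_measurable \<nu>" unfolding r_def by (rule return_time_measurable)
  have r_nonneg: "0 \<le> r x" for x by (simp add: r_def)
  have ren_int: "ren n \<inter> space \<nu> \<in> sets \<nu>" using ren_sets_nu by simp
  define M where "M = restrict_space \<nu> (ren n)"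
  have spM: "space M = ren n" using ren_subset_X by (auto simp: M_def space_restrict_space space_nu)
  have rM [measurable]: "r \<in> borel_measurable M" unfolding M_def by (rule measurable_restrict_space1) simp
  have "sets M = sets (restrict_space borelX (ren n))"
    unfolding M_def by (rule sets_restrict_space_cong[OF sets_nu])
  then have rho [measurable]: "rho ^^ n \<in> measurable M borelX"
    using rho_pow_measurable measurable_cong_sets by blast
  define P where "P = push \<nu> n"
  have P: "P = distr M borelX (rho ^^ n)" by (simp add: P_def push_def M_def)
  define D where "D = distr (density M (\<lambda>x. ennreal (r x))) borelX (rho ^^ n)"
  have rhoD: "rho ^^ n \<in> measurable (density M (\<lambda>x. ennreal (r x))) borelX" using rho by simp
  have emD: "emeasure D B = (\<integral>\<^sup>+x. ennreal (r x * indicator {x \<in> ren n. (rho ^^ n) x \<in> B} x) \<partial>\<nu>)"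
    if B: "B \<in> sets borelX" for B
  proof -
    have "emeasure D B = emeasure (density M (\<lambda>x. ennreal (r x))) ((rho ^^ n) -` B \<inter> space M)"
      unfolding D_def by (subst emeasure_distr[OF rhoD B]) simp
    also have "\<dots> = (\<integral>\<^sup>+x. ennreal (r x) * indicator ((rho ^^ n) -` B \<inter> space M) x \<partial>M)"
      using measurable_sets[OF rho B] by (subst emeasure_density) auto
    also have "\<dots> = (\<integral>\<^sup>+x. ennreal (r x) * indicator ((rho ^^ n) -` B \<inter> space M) x * indicator (ren n) x \<partial>\<nu>)"
      unfolding M_def by (rule nn_integral_restrict_space[OF ren_int])
    also have "\<dots> = (\<integral>\<^sup>+x. ennreal (r x * indicator {x \<in> ren n. (rho ^^ n) x \<in> B} x) \<partial>\<nu>)"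
      by (intro nn_integral_cong) (auto simp: spM[unfolded M_def] M_def split: split_indicator)
    finally show ?thesis .
  qed
  have finD: "finite_measure D"
  proof (rule finite_measureI)
    \<comment> \<open>The total mass is the integral of the return time, hence the measure of
      \<open>orb n\<close>, which is finite.\<close>
    have "emeasure D (space D) = (\<integral>\<^sup>+x. ennreal (r x * indicator {x \<in> ren n. (rho ^^ n) x \<in> X} x) \<partial>\<nu>)"
      using emD[of X] by (simp add: D_def space_borelX sets_borelX)
    also have "\<dots> = (\<integral>\<^sup>+x\<in>ren n. ennreal (real (return_time n x)) \<partial>\<nu>)"
      using rho_pow_in_X by (intro nn_integral_cong) (auto simp: r_def split: split_indicator)
    finally show "emeasure D (space D) \<noteq> \<infinity>" by (simp add: nn_integral_return_time)
  qed
  have finP: "finite_measure P"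
    unfolding P by (rule finite_measure.finite_measure_distr[OF _ rho])
      (auto simp: M_def intro!: finite_measure_restrict_space ren_sets_nu fin)
  have setsD: "sets D = sets P" by (simp add: D_def P)
  have ac: "absolutely_continuous P D"
    unfolding absolutely_continuous_def
  proof
    fix B assume "B \<in> null_sets P"
    then have B: "B \<in> sets borelX" and "emeasure M ((rho ^^ n) -` B \<inter> space M) = 0"
      by (auto simp: P null_sets_def emeasure_distr[OF rho])
    then have "(rho ^^ n) -` B \<inter> space M \<in> null_sets M" using measurable_sets[OF rho B] by auto
    then have "AE x in M. x \<notin> (rho ^^ n) -` B \<inter> space M" by (rule AE_not_in)
    then have "(\<integral>\<^sup>+x. ennreal (r x) * indicator ((rho ^^ n) -` B \<inter> space M) x \<partial>M) = 0"
      using measurable_sets[OF rho B] by (subst nn_integral_0_iff_AE) (auto elim!: eventually_mono)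
    moreover have "emeasure D B = (\<integral>\<^sup>+x. ennreal (r x) * indicator ((rho ^^ n) -` B \<inter> space M) x \<partial>M)"
      unfolding D_def using measurable_sets[OF rho B]
      by (subst emeasure_distr[OF rhoD B]) (simp add: emeasure_density)
    ultimately show "B \<in> null_sets D" using B by (simp add: null_sets_def D_def)
  qed
  interpret P: finite_measure P by (rule finP)
  \<comment> \<open>As \<open>D\<close> is finite, the derivative has a real-valued nonnegative
    version.\<close>
  obtain g where g: "g \<in> borel_measurable P" "AE x in P. RN_deriv P D x = ennreal (g x)"
    "AE x in D. 0 < g x" "\<And>x. 0 \<le> g x"
    by (rule P.real_RN_deriv[OF finD ac setsD]) (rule that)
  have emDg: "emeasure D B = (\<integral>\<^sup>+x. ennreal (g x * indicator B x) \<partial>P)" if B: "B \<in> sets borelX" for B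
  proof -
    have BP: "B \<in> sets P" using B by (simp add: P)
    have "emeasure D B = emeasure (density P (RN_deriv P D)) B"
      by (simp add: P.density_RN_deriv[OF ac setsD])
    also have "\<dots> = (\<integral>\<^sup>+x. RN_deriv P D x * indicator B x \<partial>P)"
      using BP by (subst emeasure_density) auto
    also have "\<dots> = (\<integral>\<^sup>+x. ennreal (g x * indicator B x) \<partial>P)"
      using g(2) by (intro nn_integral_cong_AE) (auto elim!: eventually_mono split: split_indicator)
    finally show ?thesis .
  qed
  have finite: "emeasure D B < \<infinity>" for B
    using finite_measure.emeasure_finite[OF finD, of B] by (simp add: less_top)
  have "integrable P g"
  proof (rule integrableI_nonneg)
    have "(\<integral>\<^sup>+x. ennreal (g x) \<partial>P) = emeasure D X"
      unfolding emDg[of X, simplified sets_borelX, simplified]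
      by (intro nn_integral_cong) (auto simp: P space_borelX)
    then show "(\<integral>\<^sup>+x. ennreal (g x) \<partial>P) < \<infinity>" using finite by simp
  qed (use g in auto)
  moreover have "set_integrable \<nu> (ren n) r"
    unfolding set_integrable_def
  proof (rule integrableI_nonneg)
    show "(\<lambda>x. indicat_real (ren n) x *\<^sub>R r x) \<in> borel_measurable \<nu>"
      using ren_sets_nu by measurable
    have "(\<integral>\<^sup>+x. ennreal (indicat_real (ren n) x *\<^sub>R r x) \<partial>\<nu>) = emeasure \<nu> (orb n)"
      unfolding nn_integral_return_time[symmetric]
      by (intro nn_integral_cong) (auto simp: r_def split: split_indicator)
    then show "(\<integral>\<^sup>+x. ennreal (indicat_real (ren n) x *\<^sub>R r x) \<partial>\<nu>) < \<infinity>"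
      using emeasure_finite[of "orb n"] by (simp add: less_top[symmetric])
  qed (simp add: r_nonneg)
  moreover have "(LINT x:{x \<in> ren n. (rho ^^ n) x \<in> B}|\<nu>. r x) = (LINT x:B|P. g x)"
    if B: "B \<in> sets borelX" for B
  proof -
    have BP: "B \<in> sets P" using B by (simp add: P)
    have "{x \<in> ren n. (rho ^^ n) x \<in> B} \<in> sets \<nu>"
      using rho_pow_vimage_borel[of B n] B ren_subset_X by (auto simp: in_sets_nu sets_borelX)
    then have "(LINT x:{x \<in> ren n. (rho ^^ n) x \<in> B}|\<nu>. r x) = enn2real (emeasure D B)"
      unfolding emD[OF B] set_lebesgue_integral_def
      by (subst integral_eq_nn_integral) (auto simp: r_nonneg mult.commute)
    moreover have "(LINT x:B|P. g x) = enn2real (emeasure D B)"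
      unfolding emDg[OF B] set_lebesgue_integral_def using g BP
      by (subst integral_eq_nn_integral) (auto simp: mult.commute)
    ultimately show ?thesis by simp
  qed
  ultimately show ?thesis unfolding is_return_cond_exp_def sum_r P_def by blast
qed

text \<open>At \<open>B = X\<close> the defining identity turns the right-hand side into the
  integral of the return time over \<open>ren n\<close>.\<close>

lemma measure_orb_eq: "measure \<nu> (orb n) = (\<integral>x. return_cond_exp \<nu> n (\<lambda>_. 1) x \<partial>push \<nu> n)"
proof -
  let ?g = "return_cond_exp \<nu> n (\<lambda>_. 1)"
  have "is_return_cond_exp \<nu> n (\<lambda>_. 1) ?g"
    unfolding return_cond_exp_def by (rule someI_ex[OF return_cond_exp_exists])
  then have "(LINT x:{x \<in> ren n. (rho ^^ n) x \<in> X}|\<nu>. return_sum n (\<lambda>_. 1) x) = (LINT x:X|push \<nu> n. ?g x)"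
    unfolding is_return_cond_exp_def by (simp add: sets_borelX)
  moreover have "{x \<in> ren n. (rho ^^ n) x \<in> X} = ren n" using rho_pow_in_X by auto
  moreover have "(LINT x:X|push \<nu> n. ?g x) = (\<integral>x. ?g x \<partial>push \<nu> n)"
    unfolding set_lebesgue_integral_def
    by (intro Bochner_Integration.integral_cong) (auto simp: push_def space_borelX)
  moreover have "(LINT x:ren n|\<nu>. return_sum n (\<lambda>_. 1) x) = measure \<nu> (orb n)"
  proof -
    have "(LINT x:ren n|\<nu>. return_sum n (\<lambda>_. 1) x) =
        enn2real (\<integral>\<^sup>+x. ennreal (indicator (ren n) x *\<^sub>R real (return_time n x)) \<partial>\<nu>)"
      unfolding set_lebesgue_integral_def return_sum_def using return_time_measurable ren_sets_nu
      by (subst integral_eq_nn_integral) auto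
    also have "(\<integral>\<^sup>+x. ennreal (indicator (ren n) x *\<^sub>R real (return_time n x)) \<partial>\<nu>) = emeasure \<nu> (orb n)"
      unfolding nn_integral_return_time[symmetric]
      by (intro nn_integral_cong) (auto split: split_indicator)
    finally show ?thesis by (simp add: measure_def)
  qed
  ultimately show ?thesis by simp
qed

text \<open>Stable periodicity is relatively open: the same neighborhoods and period serve every
  point of U \<times> U' \<times> {v}, and the direction factor is discrete. So \<open>NS\<close> is
  \<open>X\<close> minus an open set.\<close>

lemma NS_sets_nu: "NS \<in> sets \<nu>"
proof -
  define G where "G = \<Union>{G. open G \<and> (\<forall>x\<in>G \<inter> X. stable_periodic x)}"
  have "open G" unfolding G_def by (rule open_Union) auto
  have "NS = X - G"
  proof (intro equalityI subsetI)
    fix x assume x: "x \<in> X - G"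
    show "x \<in> NS"
    proof (rule ccontr)
      assume "x \<notin> NS"
      then have st: "stable_periodic x" using x by (simp add: NS_def)
      obtain w u v where wuv: "x = (w, u, v)" by (metis surj_pair)
      from st[unfolded wuv stable_periodic.simps] obtain L U U' where L: "L \<ge> 1"
        "openin (top_of_set Omega) U" "w \<in> U" "openin (top_of_set Omega) U'" "u \<in> U'"
        "\<forall>w'\<in>U. \<forall>u'\<in>U'. (Phi ^^ L) (w', u', v) = (w', u', v)"
        by (elim exE conjE) (rule that)
      obtain T T' where T: "open T" "U = Omega \<inter> T" "open T'" "U' = Omega \<inter> T'"
        using L(2,4) by (auto simp: openin_open)
      have "open {v}" using open_Times[OF open_discrete open_discrete, of "{fst v}" "{snd v}"] by simp
      then have op: "open (T \<times> T' \<times> {v})" using T by (intro open_Times)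
      have "stable_periodic y" if yT: "y \<in> (T \<times> T' \<times> {v}) \<inter> X" for y
      proof -
        obtain w' u' where y: "y = (w', u', v)" "w' \<in> U" "u' \<in> U'" using yT T by (auto simp: X_def)
        show ?thesis
          unfolding y stable_periodic.simps
          by (rule exI[of _ L], rule conjI[OF L(1)], rule exI[of _ U], rule exI[of _ U'])
            (intro conjI L y)
      qed
      with op have "T \<times> T' \<times> {v} \<subseteq> G" unfolding G_def by blast
      moreover have "x \<in> T \<times> T' \<times> {v}" using L T by (simp add: wuv)
      ultimately show False using x by blast
    qed
  qed (auto simp: NS_def G_def)
  moreover have "X - G \<in> sets borel" using \<open>open G\<close> by (intro sets.Diff borel_X borel_open)
  ultimately show ?thesis by (auto simp: in_sets_nu)
qed

lemma NUC_subset_X: "NUC \<subseteq> X"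
  by (auto simp: NUC_def)

lemma tendsto_measure_orb:
  assumes rob: "robustly_renormalizable \<nu>"
  shows "(\<lambda>n. measure \<nu> (orb n)) \<longlonglongrightarrow> measure \<nu> NS"
proof -
  define Bad where "Bad n = {x \<in> ren n. (rho ^^ n) x \<in> NUC}" for n
  have Bad_sets: "Bad n \<in> sets \<nu>" for n
    unfolding Bad_def using rho_pow_vimage_borel[OF borel_NUC] ren_subset_X by (auto simp: in_sets_nu)
  have Bad_null: "emeasure \<nu> (Bad n) = 0" for n
  proof -
    have "sets (restrict_space \<nu> (ren n)) = sets (restrict_space borelX (ren n))"
      by (rule sets_restrict_space_cong[OF sets_nu])
    then have rho: "rho ^^ n \<in> measurable (restrict_space \<nu> (ren n)) borelX"
      using rho_pow_measurable measurable_cong_sets by blast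
    have NUC: "NUC \<in> sets borelX" by (simp add: sets_borelX NUC_subset_X)
    have "Bad n = (rho ^^ n) -` NUC \<inter> space (restrict_space \<nu> (ren n))"
      using ren_subset_X by (auto simp: Bad_def space_restrict_space space_nu)
    moreover have "emeasure (push \<nu> n) NUC = 0" using rob by (simp add: robustly_renormalizable_def)
    ultimately have "emeasure (restrict_space \<nu> (ren n)) (Bad n) = 0"
      unfolding push_def using emeasure_distr[OF rho NUC] by simp
    then show ?thesis
      using emeasure_restrict_space[of "ren n" \<nu> "Bad n"] ren_sets_nu[of n] by (auto simp: Bad_def)
  qed
  \<comment> \<open>By invariance the preimages of the null sets \<open>Bad n\<close> under all
    iterates are null. Countably many of them contain every point to which
    \<open>NS_entering_Suc\<close> might fail to apply.\<close>
  have "AE x in \<nu>. (Phi ^^ t) x \<notin> Bad n" for t n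
  proof (rule AE_I')
    show "(Phi ^^ t) -` Bad n \<inter> space \<nu> \<in> null_sets \<nu>"
      using emeasure_Phi_pow_vimage[OF Bad_sets] Bad_null
        measurable_sets[OF measurable_funpow[OF Phi_measurable_nu] Bad_sets] by auto
  qed auto
  then have AE_bad: "AE x in \<nu>. \<forall>n t. (Phi ^^ t) x \<notin> Bad n" by (simp add: AE_all_countable)
  have "AE x in \<nu>. x \<in> NS \<longleftrightarrow> x \<in> (\<Inter>n. entering n)"
    using AE_bad AE_space
  proof eventually_elim
    case (elim x)
    have "x \<in> entering n" if "x \<in> NS" for n
    proof (induction n)
      case 0
      have "(Phi ^^ 0) x \<in> ren 0" using elim(2) by (simp add: space_nu)
      then show ?case using elim(2) unfolding entering_def space_nu by blast
    next
      case (Suc n)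
      show ?case
        by (rule NS_entering_Suc[OF that Suc]) (use elim(1) in \<open>auto simp: Bad_def\<close>)
    qed
    then show ?case using entering_all_imp_NS[of x] by auto
  qed
  moreover have INT_sets: "(\<Inter>n. entering n) \<in> sets \<nu>" using entering_sets_nu by auto
  ultimately have "measure \<nu> NS = measure \<nu> (\<Inter>n. entering n)"
    using NS_sets_nu by (intro measure_eq_AE)
  moreover have "decseq entering"
    using ren_Suc_subset by (intro decseq_SucI) (force simp: entering_def simp del: ren.simps)
  then have "(\<lambda>n. measure \<nu> (entering n)) \<longlonglongrightarrow> measure \<nu> (\<Inter>n. entering n)"
    using entering_sets_nu by (intro finite_Lim_measure_decseq) auto
  moreover have "measure \<nu> (orb n) = measure \<nu> (entering n)" for n
    by (simp add: measure_def emeasure_orb)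
  ultimately show ?thesis by simp
qed

end

theorem corollary24:
  fixes \<nu> :: "point measure"
  assumes "finite_measure \<nu>"
    and "sets \<nu> = sets borelX"
    and "Phi_invariant \<nu>"
    and "robustly_renormalizable \<nu>"
  shows "(\<forall>n. measure \<nu> (orb n) = (\<integral>x. return_cond_exp \<nu> n (\<lambda>_. 1) x \<partial>push \<nu> n)) \<and>
         (\<lambda>n. measure \<nu> (orb n)) \<longlonglongrightarrow> measure \<nu> NS"
  using measure_orb_eq[OF assms(1-3)] tendsto_measure_orb[OF assms] by blast

end
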